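(* Let $E$ be an r.i. space on $[0,1]$ such that $E\supset L_p[0,1]$ for some $p<\infty$, and let $1\le q<\infty$. Then $$\|T_qx\|_E\approx\|Ux\|_E+\Big(\frac1n\sum_{k=n+1}^{n^2}(x_k^* )^q\Big)^{1/q}$$ for all positive integers $n$ and all real $n\times n$ matrices $x$, with equivalence constants independent of $x$ and $n$.
   Context: For a measurable $x$ on $[0,1]$, $x^*(t)$ is the decreasing rearrangement of $|x|$. A Banach space $E$ of measurable functions on $[0,1]$ is rearrangement invariant (r.i.) if $y\in E$ and $x^*\le y^*$ imply $x\in E$ and $\|x\|_E\le\|y\|_E$. Standing assumptions: $\|1\|_E=1$, and $E$ is maximal or minimal in the sense of Lindenstrauss and Tzafriri (e.g. $E$ is separable or isometric to the dual of a separable r.i. space); thus for $x\in E$, $x\ge 0$, $\lim_{t\to\infty}\|\min\{x,t\}\|_E=\|x\|_E$, and $\int_0^\tau x^*\le\int_0^\tau y^*$ for all $\tau\in[0,1]$ implies $\|x\|_E\le\|y\|_E$. For a real $n\times n$ matrix $x=(x_{ij})$, $x_1^*\ge x_2^*\ge\dots\ge x_{n^2}^*$ is the decreasing rearrangement of the numbers $|x_{ij}|$. Let $S_n$ be the group of permutations of $\{1,\dots,n\}$ and $\ell:S_n\to\{1,\dots,n!\}$ a bijection. For $1\le q<\infty$ define the step function on $[0,1)$ $$T_qx(t)=\Big(\sum_{i=1}^n|x_{i,\pi(i)}|^q\Big)^{1/q},\qquad t\in\Big[\tfrac{\ell(\pi)-1}{n!},\tfrac{\ell(\pi)}{n!}\Big);$$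 $\|T_qx\|_E$ does not depend on $\ell$. Define also $Ux(t)=\sum_{k=1}^n x_k^*\chi_{((k-1)/n,k/n)}(t)$. *)

theory Defs
  imports "HOL-Analysis.Analysis"
begin

text \<open>Functions on \<open>[0,1]\<close> are represented by total functions on the reals whose values
  outside \<open>[0,1]\<close> are never inspected. A space of (classes of) measurable functions is a set
  \<open>E\<close> of such functions with a norm functional \<open>N\<close> that is only meaningful on \<open>E\<close>; the norm
  is definite up to equality almost everywhere.\<close>

abbreviation unit_measure :: "real measure"
  where "unit_measure \<equiv> lebesgue_on {0..1}"

text \<open>Extended-valued, since \<open>x\<^sup>*(0)\<close> is the essential supremum of \<open>\<bar>x\<bar>\<close>.\<close>

definition decr_rearr :: "(real \<Rightarrow> real) \<Rightarrow> real \<Rightarrow> ennreal" where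
  "decr_rearr x t =
     Inf {ennreal s | s. s \<ge> 0 \<and> emeasure unit_measure {u \<in> {0..1}. s < \<bar>x u\<bar>} \<le> ennreal t}"

locale ri_space =
  fixes E :: "(real \<Rightarrow> real) set" and N :: "(real \<Rightarrow> real) \<Rightarrow> real"
  assumes measurable: "x \<in> E \<Longrightarrow> x \<in> borel_measurable unit_measure"
    and zero_mem: "(\<lambda>t. 0) \<in> E"
    and add_mem: "x \<in> E \<Longrightarrow> y \<in> E \<Longrightarrow> (\<lambda>t. x t + y t) \<in> E"
    and scale_mem: "x \<in> E \<Longrightarrow> (\<lambda>t. c * x t) \<in> E"
    and norm_eq_0: "x \<in> E \<Longrightarrow> N x = 0 \<longleftrightarrow> (AE t in unit_measure. x t = 0)"
    and norm_triangle: "x \<in> E \<Longrightarrow> y \<in> E \<Longrightarrow> N (\<lambda>t. x t + y t) \<le> N x + N y"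
    and norm_scale: "x \<in> E \<Longrightarrow> N (\<lambda>t. c * x t) = \<bar>c\<bar> * N x"
    and complete: "(\<And>m. u m \<in> E) \<Longrightarrow>
        (\<And>e. e > 0 \<Longrightarrow> \<exists>K. \<forall>m\<ge>K. \<forall>k\<ge>K. N (\<lambda>t. u m t - u k t) < e) \<Longrightarrow>
        \<exists>x\<in>E. (\<lambda>m. N (\<lambda>t. u m t - x t)) \<longlonglongrightarrow> 0"
    and rearrangement_invariant: "y \<in> E \<Longrightarrow> x \<in> borel_measurable unit_measure \<Longrightarrow>
        (\<And>t. t \<in> {0..1} \<Longrightarrow> decr_rearr x t \<le> decr_rearr y t) \<Longrightarrow> x \<in> E \<and> N x \<le> N y"

definition ext_norm ::
  "(real \<Rightarrow> real) set \<Rightarrow> ((real \<Rightarrow> real) \<Rightarrow> real) \<Rightarrow> (real \<Rightarrow> real) \<Rightarrow> ennreal" where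
  "ext_norm E N x = (if x \<in> E then ennreal (N x) else \<infinity>)"

text \<open>The norm of the Koethe dual (associate space) of the space of all measurable functions
  with finite \<open>\<phi>\<close>.\<close>

definition koethe_dual_norm :: "((real \<Rightarrow> real) \<Rightarrow> ennreal) \<Rightarrow> (real \<Rightarrow> real) \<Rightarrow> ennreal" where
  "koethe_dual_norm \<phi> g =
     (SUP f \<in> {f \<in> borel_measurable unit_measure. \<phi> f \<le> 1}.
        \<integral>\<^sup>+ t. ennreal \<bar>f t * g t\<bar> \<partial>unit_measure)"

definition bidual_norm ::
  "(real \<Rightarrow> real) set \<Rightarrow> ((real \<Rightarrow> real) \<Rightarrow> real) \<Rightarrow> (real \<Rightarrow> real) \<Rightarrow> ennreal" where
  "bidual_norm E N = koethe_dual_norm (koethe_dual_norm (ext_norm E N))"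

definition bidual ::
  "(real \<Rightarrow> real) set \<Rightarrow> ((real \<Rightarrow> real) \<Rightarrow> real) \<Rightarrow> (real \<Rightarrow> real) set" where
  "bidual E N = {x \<in> borel_measurable unit_measure. bidual_norm E N x < \<infinity>}"

text \<open>Maximality and minimality in the sense of Lindenstrauss and Tzafriri (Classical Banach
  Spaces II, Section 2.a): \<open>E\<close> embeds isometrically in its second Koethe dual \<open>E''\<close>, and
  either \<open>E = E''\<close> or \<open>E\<close> is the closure in \<open>E''\<close> of the simple functions.\<close>

definition maximal_space :: "(real \<Rightarrow> real) set \<Rightarrow> ((real \<Rightarrow> real) \<Rightarrow> real) \<Rightarrow> bool" where
  "maximal_space E N \<longleftrightarrow>
     (\<forall>x\<in>E. bidual_norm E N x = ennreal (N x)) \<and> E = bidual E N"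

definition minimal_space :: "(real \<Rightarrow> real) set \<Rightarrow> ((real \<Rightarrow> real) \<Rightarrow> real) \<Rightarrow> bool" where
  "minimal_space E N \<longleftrightarrow>
     (\<forall>x\<in>E. bidual_norm E N x = ennreal (N x)) \<and>
     E = {x \<in> bidual E N.
            \<forall>e>0. \<exists>s. simple_function unit_measure s \<and> bidual_norm E N (\<lambda>t. x t - s t) < e}"

definition Lp_set :: "real \<Rightarrow> (real \<Rightarrow> real) set" where
  "Lp_set p = {x \<in> borel_measurable unit_measure. integrable unit_measure (\<lambda>t. \<bar>x t\<bar> powr p)}"

text \<open>A real \<open>n \<times> n\<close> matrix is a function of two indices, read only on \<open>{1..n} \<times> {1..n}\<close>;
  \<open>matrix_rearr n x k\<close> is \<open>x\<^sub>k\<^sup>*\<close>, meaningful for \<open>1 \<le> k \<le> n\<^sup>2\<close>.\<close>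

definition matrix_rearr :: "nat \<Rightarrow> (nat \<Rightarrow> nat \<Rightarrow> real) \<Rightarrow> nat \<Rightarrow> real" where
  "matrix_rearr n x k =
     rev (sort [\<bar>x i j\<bar>. i \<leftarrow> [1..<Suc n], j \<leftarrow> [1..<Suc n]]) ! (k - 1)"

definition T_op ::
  "real \<Rightarrow> nat \<Rightarrow> ((nat \<Rightarrow> nat) \<Rightarrow> nat) \<Rightarrow> (nat \<Rightarrow> nat \<Rightarrow> real) \<Rightarrow> real \<Rightarrow> real" where
  "T_op q n l x t =
     (\<Sum>\<pi> | \<pi> permutes {1..n}.
        (\<Sum>i=1..n. \<bar>x i (\<pi> i)\<bar> powr q) powr (1/q) *
        indicator {(real (l \<pi>) - 1) / fact n ..< real (l \<pi>) / fact n} t)"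

definition U_op :: "nat \<Rightarrow> (nat \<Rightarrow> nat \<Rightarrow> real) \<Rightarrow> real \<Rightarrow> real" where
  "U_op n x t =
     (\<Sum>k=1..n. matrix_rearr n x k *
        indicator {(real k - 1) / real n <..< real k / real n} t)"

end

theory Submission
  imports Defs
begin

text \<open>All entries may be taken nonnegative. For a uniformly random permutation \<open>\<pi>\<close> and a nonnegative
  matrix \<open>y\<close>, expanding the product over subsets of rows and dropping injectivity gives
  \<open>\<bbbE> (\<Prod>\<^sub>i (1 + y\<^sub>i\<^sub>\<pi>\<^sub>(\<^sub>i\<^sub>))) \<le> exp (e/n \<Sum>\<^sub>i\<^sub>j y\<^sub>i\<^sub>j)\<close>, so diagonal sums have exponential tails; a second
  moment bound and the Paley-Zygmund inequality give matching lower bounds for their distribution.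

  Lower estimate: the random diagonal meets the \<open>k \<le> n\<close> largest entries with probability at least
  \<open>k/(12n)\<close>, which compares the distribution functions of \<open>Ux\<close> and \<open>T\<^sub>qx\<close>. If the mean \<open>m\<close> of the
  \<open>q\<close>-sum of the entries beyond the \<open>n\<close>-th exceeds \<open>(x\<^sub>n\<^sup>*)\<^sup>q\<close>, this \<open>q\<close>-sum is at least \<open>m/2\<close> with
  probability at least \<open>1/12\<close>; otherwise \<open>m\<^bsup>1/q\<^esup> \<le> x\<^sub>n\<^sup>*\<close>.

  Upper estimate: let \<open>R\<close> be the right-hand side and \<open>k = \<lceil>nt\<rceil>\<close>. With probability \<open>1 - O(t)\<close> one has
  \<open>T\<^sub>qx \<le> J x\<^sub>k\<^sup>* + \<epsilon>\<^sup>-\<^sup>1 R t\<^bsup>-2\<epsilon>\<^esup>\<close>, where \<open>J \<ge> 1/\<epsilon>\<close>. Hence \<open>T\<^sub>qx\<close> is dominated, up to a dilation, by a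
  multiple of \<open>Ux\<close> plus \<open>R\<close> times a fixed power function, which lies in \<open>L\<^sub>p \<subseteq> E\<close> for \<open>\<epsilon> = 1/(4p)\<close>.\<close>

section \<open>Diagonal sums along random permutations\<close>

text \<open>Conditioning on the image \<open>b\<close> of \<open>a\<close>: what remains is a
  permutation \<open>p\<close> that fixes \<open>a\<close>, followed by one transposition.\<close>

lemma sum_permutes_remove:
  fixes F :: "('a \<Rightarrow> 'a) \<Rightarrow> 'b::comm_monoid_add"
  assumes "finite X" "a \<in> X"
  shows "(\<Sum>\<pi> | \<pi> permutes X. F \<pi>) =
    (\<Sum>b\<in>X. \<Sum>p | p permutes (X - {a}). F (Transposition.transpose a b \<circ> p))"
  using sum_over_permutations_insert[of "X - {a}" a F] assms by (simp only: insert_Diff) auto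

lemma permutes_fixes: "p permutes (X - {a}) \<Longrightarrow> p a = a"
  by (rule permutes_not_in) auto

lemma sum_permutes_single:
  fixes y :: "'a \<Rightarrow> 'a \<Rightarrow> real"
  assumes "finite X" "a \<in> X"
  shows "(\<Sum>\<pi> | \<pi> permutes X. y a (\<pi> a)) = fact (card X - 1) * (\<Sum>j\<in>X. y a j)"
proof -
  have "(\<Sum>\<pi> | \<pi> permutes X. y a (\<pi> a)) = (\<Sum>b\<in>X. \<Sum>p | p permutes (X - {a}). y a b)"
    unfolding sum_permutes_remove[OF assms]
    by (intro sum.cong refl) (auto dest: permutes_fixes)
  then show ?thesis
    using assms by (simp add: card_permutations sum_distrib_left)
qed

lemma sum_permutes_sum:
  fixes a :: "nat \<Rightarrow> nat \<Rightarrow> real"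
  shows "(\<Sum>\<pi> | \<pi> permutes {1..n}. \<Sum>i=1..n. a i (\<pi> i))
    = fact (n - 1) * (\<Sum>i=1..n. \<Sum>j=1..n. a i j)"
proof -
  have "(\<Sum>\<pi> | \<pi> permutes {1..n}. \<Sum>i=1..n. a i (\<pi> i))
      = (\<Sum>i=1..n. \<Sum>\<pi> | \<pi> permutes {1..n}. a i (\<pi> i))" by (rule sum.swap)
  also have "\<dots> = (\<Sum>i=1..n. fact (n - 1) * (\<Sum>j=1..n. a i j))"
    using sum_permutes_single[of "{1..n}" _ a] by (intro sum.cong) auto
  finally show ?thesis by (simp add: sum_distrib_left)
qed

text \<open>Induction on \<open>card S\<close>. Once the image \<open>b\<close> of one row is fixed,
  the transposition merely relabels the columns of the other rows, so the hypothesis applies to the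
  relabelled matrix.\<close>

lemma sum_permutes_prod_le:
  fixes y :: "'a \<Rightarrow> 'a \<Rightarrow> real"
  assumes "finite X" "S \<subseteq> X" "\<And>i j. y i j \<ge> 0"
  shows "(\<Sum>\<pi> | \<pi> permutes X. \<Prod>i\<in>S. y i (\<pi> i))
           \<le> fact (card X - card S) * (\<Prod>i\<in>S. \<Sum>j\<in>X. y i j)"
  using assms
proof (induction "card S" arbitrary: S X y)
  case 0
  then have "S = {}" using finite_subset by fastforce
  then show ?case using 0 by (simp add: card_permutations)
next
  case (Suc m)
  then obtain a S' where S: "S = insert a S'" "a \<notin> S'" "card S' = m"
    by (metis card_Suc_eq)
  have fin: "finite S'" "finite S" and aX: "a \<in> X" and S'X: "S' \<subseteq> X - {a}"
    using S Suc.prems finite_subset by auto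
  have step: "(\<Sum>p | p permutes (X - {a}). \<Prod>i\<in>S'. y i (Transposition.transpose a b (p i)))
      \<le> fact (card X - card S) * (\<Prod>i\<in>S'. \<Sum>j\<in>X. y i j)" if b: "b \<in> X" for b
  proof -
    have "(\<Sum>p | p permutes (X - {a}). \<Prod>i\<in>S'. y i (Transposition.transpose a b (p i)))
        \<le> fact (card (X - {a}) - card S') *
          (\<Prod>i\<in>S'. \<Sum>j\<in>X - {a}. y i (Transposition.transpose a b j))"
      using Suc.hyps(1)[of S' "X - {a}" "\<lambda>i j. y i (Transposition.transpose a b j)"] S S'X Suc.prems by auto
    also have "card (X - {a}) - card S' = card X - card S"
      using S fin Suc.prems aX by simp
    \<comment> \<open>The missing index \<open>j = a\<close> stands for column \<open>b\<close>,
      which row \<open>a\<close> already occupies. Allowing it again makes the bound independent of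
      \<open>b\<close>.\<close>
    also have "(\<Prod>i\<in>S'. \<Sum>j\<in>X - {a}. y i (Transposition.transpose a b j)) \<le> (\<Prod>i\<in>S'. \<Sum>j\<in>X. y i j)"
    proof (intro prod_mono conjI sum_nonneg)
      fix i
      have "(\<Sum>j\<in>X - {a}. y i (Transposition.transpose a b j)) \<le> (\<Sum>j\<in>X. y i (Transposition.transpose a b j))"
        using Suc.prems by (intro sum_mono2) auto
      also have "\<dots> = (\<Sum>j\<in>X. y i j)"
        using sum.permute[of "Transposition.transpose a b" X "y i"] permutes_swap_id[OF aX b] by (simp add: o_def)
      finally show "(\<Sum>j\<in>X - {a}. y i (Transposition.transpose a b j)) \<le> (\<Sum>j\<in>X. y i j)" .
    qed (use Suc.prems in auto)
    finally show ?thesis by (simp add: mult_left_mono)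
  qed
  have "(\<Sum>\<pi> | \<pi> permutes X. \<Prod>i\<in>S. y i (\<pi> i)) =
      (\<Sum>b\<in>X. \<Sum>p | p permutes (X - {a}). y a b * (\<Prod>i\<in>S'. y i (Transposition.transpose a b (p i))))"
    unfolding sum_permutes_remove[OF \<open>finite X\<close> aX]
    using S fin by (intro sum.cong refl) (auto dest: permutes_fixes)
  also have "\<dots> = (\<Sum>b\<in>X. y a b * (\<Sum>p | p permutes (X - {a}).
      \<Prod>i\<in>S'. y i (Transposition.transpose a b (p i))))"
    by (simp add: sum_distrib_left)
  also have "\<dots> \<le> (\<Sum>b\<in>X. y a b * (fact (card X - card S) * (\<Prod>i\<in>S'. \<Sum>j\<in>X. y i j)))"
    by (intro sum_mono mult_left_mono step) (use Suc.prems in auto)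
  also have "\<dots> = fact (card X - card S) * (\<Prod>i\<in>S. \<Sum>j\<in>X. y i j)"
    using S fin by (simp add: sum_distrib_right[symmetric] mult_ac)
  finally show ?case .
qed

text \<open>Each induction step costs (1 + 1/m)^j <= (1 + 1/m)^m <= e. The bound replaces (n -
  j)!/n! by (e/n)^j, which is multiplicative in the chosen rows.\<close>

lemma power_le_exp_fact:
  assumes "j \<le> n"
  shows "real n ^ j * fact (n - j) \<le> exp 1 ^ j * fact n"
  using assms
proof (induction j arbitrary: n)
  case 0
  then show ?case by simp
next
  case (Suc j)
  then obtain m where n: "n = Suc m" "j \<le> m" by (cases n) auto
  have "real (Suc m) ^ j \<le> exp 1 * real m ^ j"
  proof (cases "m = 0")
    case True
    then show ?thesis using n by simp
  next
    case False
    have "(real (Suc m) / real m) ^ j = (1 + 1 / real m) ^ j"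
      using False by (simp add: field_simps)
    also have "\<dots> \<le> (1 + 1 / real m) ^ m"
      by (rule power_increasing) (use n in auto)
    also have "\<dots> \<le> exp 1"
      using exp_ge_one_plus_x_over_n_power_n[of m 1] False by simp
    finally show ?thesis using False by (simp add: field_simps power_divide)
  qed
  then have "real n ^ Suc j * fact (n - Suc j) \<le> real n * (exp 1 * real m ^ j) * fact (m - j)"
    using n by (simp add: mult_mono)
  also have "\<dots> = exp 1 * real n * (real m ^ j * fact (m - j))" by simp
  also have "\<dots> \<le> exp 1 * real n * (exp 1 ^ j * fact m)"
    by (intro mult_left_mono Suc.IH n) auto
  also have "\<dots> = exp 1 ^ Suc j * fact n" using n by simp
  finally show ?case .
qed

text \<open>With the weight (e/n)^\<open>card S\<close> the sum over subsets \<open>S\<close>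
  factors back into a product over rows, and 1 + z <= exp z finishes.\<close>

lemma sum_permutes_prod_one_plus_le:
  fixes y :: "nat \<Rightarrow> nat \<Rightarrow> real"
  assumes n: "n \<ge> 1" and y: "\<And>i j. y i j \<ge> 0"
  shows "(\<Sum>\<pi> | \<pi> permutes {1..n}. \<Prod>i=1..n. 1 + y i (\<pi> i))
     \<le> fact n * exp (exp 1 / real n * (\<Sum>i=1..n. \<Sum>j=1..n. y i j))"
proof -
  let ?r = "\<lambda>i. \<Sum>j=1..n. y i j" and ?c = "exp 1 / real n :: real"
  have r: "?r i \<ge> 0" for i by (simp add: sum_nonneg y)
  have "(\<Sum>\<pi> | \<pi> permutes {1..n}. \<Prod>i=1..n. 1 + y i (\<pi> i)) =
    (\<Sum>\<pi> | \<pi> permutes {1..n}. \<Sum>S\<in>Pow {1..n}. \<Prod>i\<in>S. y i (\<pi> i))"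
    using prod_add[of "{1..n}" "\<lambda>i. y i (\<pi> i)" "\<lambda>i. 1" for \<pi>] by (simp add: add.commute)
  also have "\<dots> = (\<Sum>S\<in>Pow {1..n}. \<Sum>\<pi> | \<pi> permutes {1..n}. \<Prod>i\<in>S. y i (\<pi> i))"
    by (rule sum.swap)
  also have "\<dots> \<le> (\<Sum>S\<in>Pow {1..n}. fact n * (\<Prod>i\<in>S. ?c * ?r i))"
  proof (rule sum_mono)
    fix S assume S: "S \<in> Pow {1..n}"
    then have c: "card S \<le> n" "finite S"
      using card_mono[of "{1..n}" S] finite_subset[of S "{1..n}"] by auto
    have "(\<Sum>\<pi> | \<pi> permutes {1..n}. \<Prod>i\<in>S. y i (\<pi> i)) \<le> fact (n - card S) * (\<Prod>i\<in>S. ?r i)"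
      using sum_permutes_prod_le[of "{1..n}" S y] S y by simp
    also have "\<dots> \<le> (fact n * ?c ^ card S) * (\<Prod>i\<in>S. ?r i)"
      using power_le_exp_fact[OF c(1)] n
      by (intro mult_right_mono prod_nonneg r) (auto simp: field_simps power_divide)
    also have "\<dots> = fact n * (\<Prod>i\<in>S. ?c * ?r i)"
      by (simp only: prod.distrib prod_constant mult.assoc)
    finally show "(\<Sum>\<pi> | \<pi> permutes {1..n}. \<Prod>i\<in>S. y i (\<pi> i)) \<le> fact n * (\<Prod>i\<in>S. ?c * ?r i)" .
  qed
  also have "\<dots> = fact n * (\<Prod>i=1..n. 1 + ?c * ?r i)"
    using prod_add[of "{1..n}" "\<lambda>i. ?c * ?r i" "\<lambda>i. 1"] by (simp add: add.commute sum_distrib_left)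
  also have "\<dots> \<le> fact n * (\<Prod>i=1..n. exp (?c * ?r i))"
    using r by (intro mult_left_mono prod_mono) (auto simp: add_nonneg_nonneg)
  also have "\<dots> = fact n * exp (?c * (\<Sum>i=1..n. ?r i))"
    by (simp add: exp_sum sum_distrib_left)
  finally show ?thesis .
qed

section \<open>Markov, Chernoff and Paley-Zygmund bounds for diagonal sums\<close>

lemma card_mult_le_sum:
  fixes f :: "'a \<Rightarrow> real"
  assumes "finite A" "\<And>a. a \<in> A \<Longrightarrow> f a \<ge> 0"
  shows "real (card {a \<in> A. f a \<ge> c}) * c \<le> sum f A"
proof -
  have "real (card {a \<in> A. f a \<ge> c}) * c = (\<Sum>a | a \<in> A \<and> f a \<ge> c. c)" by simp
  also have "\<dots> \<le> (\<Sum>a | a \<in> A \<and> f a \<ge> c. f a)" by (intro sum_mono) auto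
  also have "\<dots> \<le> sum f A" using assms by (intro sum_mono2) auto
  finally show ?thesis .
qed

text \<open>Markov's inequality for the exponential of the diagonal sum, which is a product of
  factors 1 + y with y = exp z - 1.\<close>

lemma card_permutes_sum_ge_exp:
  fixes z :: "nat \<Rightarrow> nat \<Rightarrow> real"
  assumes n: "n \<ge> 1" and z: "\<And>i j. z i j \<ge> 0"
  shows "real (card {\<pi>. \<pi> permutes {1..n} \<and> (\<Sum>i=1..n. z i (\<pi> i)) \<ge> s})
     \<le> fact n * exp (exp 1 / real n * (\<Sum>i=1..n. \<Sum>j=1..n. exp (z i j) - 1) - s)"
proof -
  let ?P = "{\<pi>. \<pi> permutes {1..n}}" and ?Z = "\<lambda>\<pi>. exp (\<Sum>i=1..n. z i (\<pi> i)) :: real"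
  have "real (card {\<pi> \<in> ?P. ?Z \<pi> \<ge> exp s}) * exp s \<le> sum ?Z ?P"
    by (rule card_mult_le_sum) (auto simp: finite_permutations)
  also have "\<dots> = (\<Sum>\<pi> | \<pi> permutes {1..n}. \<Prod>i=1..n. 1 + (exp (z i (\<pi> i)) - 1))"
    by (simp add: exp_sum)
  also have "\<dots> \<le> fact n * exp (exp 1 / real n * (\<Sum>i=1..n. \<Sum>j=1..n. exp (z i j) - 1))"
    using sum_permutes_prod_one_plus_le[OF n, of "\<lambda>i j. exp (z i j) - 1"] z by simp
  finally show ?thesis by (simp add: exp_diff field_simps)
qed

lemma power2_fact_le:
  assumes "n \<ge> 2"
  shows "fact (n - 2) * (real n)\<^sup>2 \<le> 2 * fact n"
proof -
  obtain l where l: "n = l + 2" using assms by (metis le_Suc_ex add.commute)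
  have eq: "fact n = (real l + 2) * (real l + 1) * fact l"
    unfolding l by (simp add: numeral_2_eq_2 add_ac)
  have "(real l + 2) * (real l + 2) \<le> 2 * ((real l + 2) * (real l + 1))"
    by (simp add: algebra_simps)
  then have "fact l * ((real l + 2) * (real l + 2)) \<le> fact l * (2 * ((real l + 2) * (real l + 1)))"
    by (rule mult_left_mono) simp
  moreover have "real n = real l + 2" "n - 2 = l" using l by auto
  ultimately show ?thesis
    unfolding eq by (simp only: power2_eq_square mult_ac)
qed

text \<open>Paley-Zygmund: the diagonal sum has mean \<open>m\<close> and second moment at most M m
  + 2 m^2. Cauchy-Schwarz on the event of reaching m/2 gives (m/2)^2 <= P (M m + 2 m^2).\<close>

lemma card_permutes_sum_ge_half_mean:
  fixes a :: "nat \<Rightarrow> nat \<Rightarrow> real"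
  assumes n: "n \<ge> 1" and a0: "\<And>i j. a i j \<ge> 0" and aM: "\<And>i j. a i j \<le> M"
    and m: "m = (\<Sum>i=1..n. \<Sum>j=1..n. a i j) / real n" and m0: "m > 0"
  shows "m / (4 * (M + 2 * m)) * fact n
    \<le> real (card {\<pi>. \<pi> permutes {1..n} \<and> (\<Sum>i=1..n. a i (\<pi> i)) \<ge> m / 2})"
proof -
  let ?P = "{\<pi>. \<pi> permutes {1..n}}" and ?Z = "\<lambda>\<pi>. \<Sum>i=1..n. a i (\<pi> i)"
  let ?G = "{\<pi>. \<pi> permutes {1..n} \<and> ?Z \<pi> \<ge> m / 2}"
  let ?r = "\<lambda>i. \<Sum>j=1..n. a i j"
  have fin: "finite ?P" by (simp add: finite_permutations)
  have cP: "card ?P = fact n" by (simp add: card_permutations)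
  have r: "?r i \<ge> 0" for i by (simp add: sum_nonneg a0)
  have sr: "(\<Sum>i=1..n. ?r i) = m * real n" using n m by simp
  have fact: "fact n = real n * fact (n - 1)" using n by (simp add: fact_reduce)
  have first: "sum ?Z ?P = m * fact n"
    unfolding sum_permutes_sum sr using fact by simp
  have M0: "M \<ge> 0" using a0[of 0 0] aM[of 0 0] by linarith
  \<comment> \<open>Equal rows are handled by a^2 <= M a, distinct rows by the product bound for two
    rows. The nonnegative second term is kept in both cases so that the double sum splits.\<close>
  have pair: "(\<Sum>\<pi>\<in>?P. a i (\<pi> i) * a k (\<pi> k)) \<le>
      (if i = k then M * fact (n - 1) * ?r i else 0) + 2 * fact n / (real n)\<^sup>2 * (?r i * ?r k)"
    if ik: "i \<in> {1..n}" "k \<in> {1..n}" for i k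
  proof (cases "i = k")
    case True
    have "(\<Sum>\<pi>\<in>?P. a i (\<pi> i) * a k (\<pi> k)) \<le> (\<Sum>\<pi>\<in>?P. M * a i (\<pi> i))"
      using True a0 aM by (auto intro!: sum_mono mult_right_mono)
    also have "\<dots> = M * (fact (n - 1) * ?r i)"
      using sum_permutes_single[of "{1..n}" i a] ik by (simp add: sum_distrib_left[symmetric])
    finally show ?thesis using True r by (simp add: add_increasing2)
  next
    case False
    then have n2: "n \<ge> 2" using ik by auto
    have "(\<Sum>\<pi>\<in>?P. a i (\<pi> i) * a k (\<pi> k)) \<le> fact (n - 2) * (?r i * ?r k)"
      using sum_permutes_prod_le[of "{1..n}" "{i,k}" a] ik False a0 by (simp add: numeral_2_eq_2)
    also have "\<dots> \<le> (2 * fact n / (real n)\<^sup>2) * (?r i * ?r k)"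
    proof (rule mult_right_mono)
      show "fact (n - 2) \<le> 2 * fact n / (real n)\<^sup>2"
        using power2_fact_le[OF n2] n by (subst pos_le_divide_eq) auto
    qed (use r in auto)
    finally show ?thesis using False by simp
  qed
  have gen: "(\<Sum>i=1..n. \<Sum>k=1..n. (if i = k then A * r i else 0) + c * (r i * r k))
      = A * (\<Sum>i=1..n. r i) + c * ((\<Sum>i=1..n. r i) * (\<Sum>i=1..n. r i))"
    for A c and r :: "nat \<Rightarrow> real"
    unfolding sum_product by (simp add: sum.distrib sum_distrib_left)
  have second: "(\<Sum>\<pi>\<in>?P. (?Z \<pi>)\<^sup>2) \<le> (M * m + 2 * m\<^sup>2) * fact n"
  proof -
    have "(\<Sum>\<pi>\<in>?P. (?Z \<pi>)\<^sup>2) = (\<Sum>\<pi>\<in>?P. \<Sum>i=1..n. \<Sum>k=1..n. a i (\<pi> i) * a k (\<pi> k))"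
      by (simp add: power2_eq_square sum_product)
    also have "\<dots> = (\<Sum>i=1..n. \<Sum>k=1..n. \<Sum>\<pi>\<in>?P. a i (\<pi> i) * a k (\<pi> k))"
      by (subst sum.swap, intro sum.cong refl, rule sum.swap)
    also have "\<dots> \<le> (\<Sum>i=1..n. \<Sum>k=1..n. (if i = k then M * fact (n - 1) * ?r i else 0)
        + 2 * fact n / (real n)\<^sup>2 * (?r i * ?r k))"
      by (intro sum_mono pair)
    also have "\<dots> = M * fact (n - 1) * (\<Sum>i=1..n. ?r i) +
        2 * fact n / (real n)\<^sup>2 * ((\<Sum>i=1..n. ?r i) * (\<Sum>i=1..n. ?r i))"
      by (rule gen)
    also have "\<dots> = (M * m + 2 * m\<^sup>2) * fact n"
    proof -
      have "M * fact (n - 1) * (m * real n) = M * m * fact n" unfolding fact by simp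
      moreover have "2 * fact n / (real n)\<^sup>2 * (m * real n * (m * real n)) = 2 * m\<^sup>2 * fact n"
        using n by (simp add: power2_eq_square)
      ultimately show ?thesis unfolding sr by (simp only: distrib_right)
    qed
    finally show ?thesis .
  qed
  \<comment> \<open>Sums below m/2 contribute at most half of the mean, so \<open>?G\<close> carries
    the other half.\<close>
  have "m * fact n \<le> (\<Sum>\<pi>\<in>?P. m / 2 + (if m / 2 \<le> ?Z \<pi> then ?Z \<pi> else 0))"
    unfolding first[symmetric] using m0 by (intro sum_mono) auto
  also have "\<dots> = m / 2 * fact n + (\<Sum>\<pi>\<in>?G. 1 * ?Z \<pi>)"
    using fin cP by (simp add: sum.distrib sum.inter_filter[symmetric] conj_commute)
  finally have "m / 2 * fact n \<le> (\<Sum>\<pi>\<in>?G. 1 * ?Z \<pi>)" by simp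
  then have "(m / 2 * fact n)\<^sup>2 \<le> (\<Sum>\<pi>\<in>?G. 1 * ?Z \<pi>)\<^sup>2"
    using m0 by (intro power_mono) auto
  also have "\<dots> \<le> (\<Sum>\<pi>\<in>?G. 1\<^sup>2) * (\<Sum>\<pi>\<in>?G. (?Z \<pi>)\<^sup>2)"
    by (rule Cauchy_Schwarz_ineq_sum)
  also have "\<dots> \<le> real (card ?G) * ((M * m + 2 * m\<^sup>2) * fact n)"
  proof -
    have "(\<Sum>\<pi>\<in>?G. (?Z \<pi>)\<^sup>2) \<le> (\<Sum>\<pi>\<in>?P. (?Z \<pi>)\<^sup>2)"
      using fin by (intro sum_mono2) auto
    then show ?thesis using second by (simp add: mult_left_mono)
  qed
  finally have "m * fact n * (m * fact n) \<le> m * fact n * (real (card ?G) * (4 * (M + 2 * m)))"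
    by (simp add: power2_eq_square algebra_simps)
  then have "m * fact n \<le> real (card ?G) * (4 * (M + 2 * m))"
    using m0 by (subst (asm) mult_le_cancel_left_pos) auto
  then show ?thesis using m0 M0 by (simp add: field_simps)
qed

section \<open>Distribution functions and rearrangement invariant norms\<close>

definition distrib :: "(real \<Rightarrow> real) \<Rightarrow> real \<Rightarrow> ennreal" where
  "distrib f s = emeasure unit_measure {u \<in> {0..1}. s < \<bar>f u\<bar>}"

lemma emeasure_unit_measure:
  "A \<in> sets borel \<Longrightarrow> A \<subseteq> {0..1} \<Longrightarrow> emeasure unit_measure A = emeasure lborel A"
  by (simp add: emeasure_restrict_space emeasure_completion)

lemma distrib_eq_lborel:
  assumes "f \<in> borel_measurable borel"
  shows "distrib f s = emeasure lborel {u \<in> {0..1}. s < \<bar>f u\<bar>}"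
  unfolding distrib_def using assms by (intro emeasure_unit_measure) auto

lemma borel_measurable_unit_measure:
  "f \<in> borel_measurable borel \<Longrightarrow> f \<in> borel_measurable unit_measure"
  for f :: "real \<Rightarrow> real"
  by (intro measurable_restrict_space1 measurable_completion) simp

lemma distrib_le_1:
  assumes "f \<in> borel_measurable borel"
  shows "distrib f s \<le> 1"
proof -
  have "distrib f s \<le> emeasure lborel {0..1::real}"
    unfolding distrib_eq_lborel[OF assms] by (intro emeasure_mono) auto
  then show ?thesis by simp
qed

lemma distrib_antimono:
  assumes "f \<in> borel_measurable borel" "s \<le> s'"
  shows "distrib f s' \<le> distrib f s"
  unfolding distrib_eq_lborel[OF assms(1)] using assms by (intro emeasure_mono) auto

text \<open>A smaller distribution function admits more levels in the infimum. This is the bridge to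
  the axiom \<open>rearrangement_invariant\<close>.\<close>

lemma decr_rearr_mono:
  assumes "\<And>s. s \<ge> 0 \<Longrightarrow> distrib f s \<le> distrib g s"
  shows "decr_rearr f t \<le> decr_rearr g t"
  unfolding decr_rearr_def
  using assms by (intro Inf_superset_mono) (auto simp: distrib_def intro: order_trans)

text \<open>Turns measures into cardinalities, since all cells have equal length. As
  \<open>s \<ge> 0\<close>, points outside the cells, where the sum is 0, do not count.\<close>

lemma distrib_step:
  fixes v :: "'k \<Rightarrow> real"
  assumes K: "finite K" and I: "\<And>k. k \<in> K \<Longrightarrow> I k \<in> sets borel"
    "\<And>k. k \<in> K \<Longrightarrow> I k \<subseteq> {0..1}" "\<And>k. k \<in> K \<Longrightarrow> emeasure lborel (I k) = ennreal (1 / G)"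
    and disj: "disjoint_family_on I K" and s: "s \<ge> 0" and G: "G > 0"
  shows "distrib (\<lambda>t. \<Sum>k\<in>K. v k * indicator (I k) t) s = ennreal (card {k \<in> K. s < \<bar>v k\<bar>} / G)"
proof -
  let ?f = "\<lambda>t. \<Sum>k\<in>K. v k * indicator (I k) t" and ?K = "{k \<in> K. s < \<bar>v k\<bar>}"
  have val: "?f t = v k" if "k \<in> K" "t \<in> I k" for k t
  proof -
    have "?f t = (\<Sum>j\<in>K. if j = k then v k else 0)"
      using that disj by (intro sum.cong) (auto simp: disjoint_family_on_def indicator_def)
    then show ?thesis using that K by simp
  qed
  have val0: "?f t = 0" if "\<And>k. k \<in> K \<Longrightarrow> t \<notin> I k" for t
    using that by (intro sum.neutral) auto
  have "{u \<in> {0..1}. s < \<bar>?f u\<bar>} = (\<Union>k\<in>?K. I k)"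
  proof (intro equalityI subsetI)
    fix u assume u: "u \<in> {u \<in> {0..1}. s < \<bar>?f u\<bar>}"
    then obtain k where k: "k \<in> K" "u \<in> I k" using val0[of u] s by fastforce
    then show "u \<in> (\<Union>k\<in>?K. I k)" using u val[OF k] by auto
  next
    fix u assume "u \<in> (\<Union>k\<in>?K. I k)"
    then obtain k where k: "k \<in> ?K" "u \<in> I k" by blast
    then show "u \<in> {u \<in> {0..1}. s < \<bar>?f u\<bar>}" using val[of k u] I(2)[of k] by auto
  qed
  moreover have "?f \<in> borel_measurable borel"
    using I(1) by (intro borel_measurable_sum borel_measurable_times borel_measurable_indicator) auto
  ultimately have "distrib ?f s = emeasure lborel (\<Union>k\<in>?K. I k)"
    by (simp add: distrib_eq_lborel)
  also have "\<dots> = (\<Sum>k\<in>?K. emeasure lborel (I k))"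
    using K I(1) disj by (intro sum_emeasure[symmetric]) (auto simp: disjoint_family_on_def)
  also have "\<dots> = (\<Sum>k\<in>?K. ennreal (1 / G))" using I(3) by (intro sum.cong) auto
  also have "\<dots> = ennreal (card ?K / G)"
    using G by (simp add: ennreal_of_nat_eq_real_of_nat ennreal_mult[symmetric])
  finally show ?thesis .
qed

text \<open>Passes from a quantile bound to a comparison of distribution functions. If
  \<open>\<tau>\<close> is the value for \<open>h\<close> at \<open>s\<close>, then h(t) <= s for
  each t in (\<open>\<tau>\<close>, 1), as otherwise \<open>h\<close> exceeds \<open>s\<close> on
  (0, t]. Now let t decrease to \<open>\<tau>\<close>; for \<open>\<tau> \<ge> 1\<close> the claim
  is trivial because \<open>D \<ge> 1\<close>.\<close>

lemma distrib_le_decreasing: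
  fixes D :: real
  assumes f: "f \<in> borel_measurable borel" and h: "h \<in> borel_measurable borel"
    and h0: "\<And>t. t \<in> {0<..<1} \<Longrightarrow> h t \<ge> 0"
    and dec: "\<And>t u. 0 < t \<Longrightarrow> t \<le> u \<Longrightarrow> u < 1 \<Longrightarrow> h u \<le> h t"
    and D: "D \<ge> 1"
    and le: "\<And>t. t \<in> {0<..<1} \<Longrightarrow> distrib f (h t) \<le> ennreal (D * t)"
  shows "distrib f s \<le> ennreal D * distrib h s"
proof -
  obtain \<tau> where \<tau>: "distrib h s = ennreal \<tau>" "\<tau> \<ge> 0"
    using distrib_le_1[OF h, of s] by (cases "distrib h s") (auto simp: top_unique)
  obtain d where d: "distrib f s = ennreal d" "d \<ge> 0" "d \<le> 1"
    using distrib_le_1[OF f, of s] by (cases "distrib f s") (auto simp: top_unique)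
  have "d \<le> D * \<tau>"
  proof (cases "\<tau> \<ge> 1")
    case True
    then show ?thesis using d D mult_mono[of 1 D 1 \<tau>] by simp
  next
    case False
    have "d / D \<le> \<tau>"
    proof (rule dense_ge_bounded)
      show "\<tau> < 1" using False by simp
      fix t assume t: "\<tau> < t" "t < 1"
      have "h t \<le> s"
      proof (rule ccontr)
        assume "\<not> h t \<le> s"
        then have "{0<..t} \<subseteq> {u \<in> {0..1}. s < \<bar>h u\<bar>}"
          using dec[of _ t] t h0 by (force simp: less_le_trans)
        then have "emeasure lborel {0<..t} \<le> distrib h s"
          unfolding distrib_eq_lborel[OF h] using h by (intro emeasure_mono) auto
        then show False using t \<tau> by (simp add: ennreal_le_iff)
      qed
      then have "distrib f s \<le> distrib f (h t)" by (rule distrib_antimono[OF f])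
      also have "\<dots> \<le> ennreal (D * t)" using t \<tau> by (intro le) auto
      finally have "d \<le> D * t" using d t \<tau> D by (simp add: ennreal_le_iff)
      then show "d / D \<le> t" using D by (simp add: field_simps)
    qed
    then show ?thesis using D by (simp add: field_simps)
  qed
  then show ?thesis using d \<tau> D by (simp add: ennreal_mult[symmetric] ennreal_leI)
qed

text \<open>The p-th power is t^(-1/2), which is integrable at 0. The upper estimate uses this
  function as its fixed majorant.\<close>

lemma powr_mem_Lp_set:
  assumes "p \<ge> 1"
  shows "(\<lambda>t. t powr (- (1 / (2 * p)))) \<in> Lp_set p"
proof -
  have "(t powr (- (1 / (2 * p)))) powr p = t powr (- (1 / 2))" for t :: real
    using assms by (simp add: powr_powr)
  moreover have "(\<lambda>t::real. t powr (- (1 / 2))) absolutely_integrable_on {0..1}"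
    by (intro nonnegative_absolutely_integrable_1 integrable_on_powr_from_0) auto
  ultimately show ?thesis
    unfolding Lp_set_def
    by (auto intro!: borel_measurable_unit_measure simp: set_integrable_def integrable_restrict_space)
qed

section \<open>Norm inequalities from distribution inequalities\<close>

context ri_space
begin

lemma mem_if_distrib_le:
  assumes "g \<in> E" "f \<in> borel_measurable borel" "\<And>s. s \<ge> 0 \<Longrightarrow> distrib f s \<le> distrib g s"
  shows "f \<in> E" "N f \<le> N g"
  using rearrangement_invariant[OF assms(1) borel_measurable_unit_measure[OF assms(2)]]
    decr_rearr_mono assms(3) by blast+

lemma norm_nonneg:
  assumes "f \<in> E" shows "N f \<ge> 0"
proof -
  have "0 = N (\<lambda>t. f t + (- 1) * f t)"
    using norm_scale[OF zero_mem, of 0] by simp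
  also have "\<dots> \<le> N f + N (\<lambda>t. (- 1) * f t)"
    by (intro norm_triangle scale_mem assms)
  also have "\<dots> = 2 * N f" using norm_scale[OF assms, of "- 1"] by simp
  finally show ?thesis by simp
qed

lemma norm_sum_le:
  assumes "finite I" "\<And>i. i \<in> I \<Longrightarrow> f i \<in> E"
  shows "(\<lambda>t. \<Sum>i\<in>I. f i t) \<in> E \<and> N (\<lambda>t. \<Sum>i\<in>I. f i t) \<le> (\<Sum>i\<in>I. N (f i))"
  using assms
proof (induction I rule: finite_induct)
  case empty
  then show ?case using zero_mem norm_scale[OF zero_mem, of 0] by simp
next
  case (insert i I)
  then show ?case
    using add_mem[of "f i" "\<lambda>t. \<Sum>i\<in>I. f i t"] norm_triangle[of "f i" "\<lambda>t. \<Sum>i\<in>I. f i t"]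
    by (simp add: order_trans[OF _ add_left_mono])
qed

text \<open>The function \<open>f (D t - r)\<close> on \<open>[r/D, (r+1)/D)\<close>, \<open>r < D\<close>, is equidistributed with \<open>f\<close>,
  and each of its \<open>D\<close> pieces has distribution function \<open>1/D\<close> times that of \<open>f\<close>.\<close>

lemma norm_le_dilation:
  fixes D :: nat
  assumes g: "g \<in> E" and f: "f \<in> borel_measurable borel" and D: "D > 0"
    and le: "\<And>s. s \<ge> 0 \<Longrightarrow> distrib f s \<le> of_nat D * distrib g s"
  shows "f \<in> E" "N f \<le> D * N g"
proof -
  define J where "J r = {real r / D ..< (real r + 1) / D}" for r
  define h where "h r t = indicator (J r) t * f (D * t - r)" for r :: nat and t :: real
  have h_borel: "h r \<in> borel_measurable borel" for r
    unfolding h_def J_def using f by measurable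
  have J: "J r \<subseteq> {0..1}" if "r < D" for r
  proof -
    have "(real r + 1) / D \<le> 1" "0 \<le> real r / D" using that by auto
    then show ?thesis unfolding J_def by (subst atLeastLessThan_subseteq_atLeastAtMost_iff) simp
  qed
  have J_iff: "u \<in> J r \<longleftrightarrow> real r \<le> D * u \<and> D * u < real r + 1" for u :: real and r
    using D by (auto simp: J_def field_simps)
  have disj: "disjoint_family J"
  proof -
    have "r = r'" if "u \<in> J r" "u \<in> J r'" for u r r'
      using that unfolding J_iff by linarith
    then show ?thesis unfolding disjoint_family_on_def by blast
  qed
  have dist_h: "of_nat D * distrib (h r) s = distrib f s" if s: "s \<ge> 0" and r: "r < D" for s r
  proof -
    \<comment> \<open>Dropping the null set {1} matches the half-open pieces \<open>J r\<close>; the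
      affine substitution v = D u - r then produces the factor \<open>D\<close>.\<close>
    let ?A = "{v \<in> {0..<1}. s < \<bar>f v\<bar>}"
    have A: "?A \<in> sets borel" using f by measurable
    have "distrib f s = emeasure lborel ?A"
      unfolding distrib_eq_lborel[OF f]
    proof (rule emeasure_eq_AE)
      show "AE x in lborel. x \<in> {u \<in> {0..1}. s < \<bar>f u\<bar>} \<longleftrightarrow> x \<in> ?A"
        using AE_lborel_singleton[of "1::real"] by eventually_elim auto
    qed (use f in measurable)
    also have "\<dots> = (\<integral>\<^sup>+ x. indicator ?A x \<partial>lborel)" using A by simp
    also have "\<dots> = ennreal \<bar>real D\<bar> * (\<integral>\<^sup>+ x. indicator ?A (- real r + real D * x) \<partial>lborel)"
      using A D by (intro nn_integral_real_affine) auto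
    also have "(\<lambda>x. indicator ?A (- real r + real D * x) :: ennreal) = indicator {u \<in> {0..1}. s < \<bar>h r u\<bar>}"
    proof
      fix x
      have "- real r + real D * x \<in> ?A \<longleftrightarrow> x \<in> {u \<in> {0..1}. s < \<bar>h r u\<bar>}"
        using J[OF r] J_iff[of x r] s by (auto simp: h_def indicator_def subset_iff)
      then show "(indicator ?A (- real r + real D * x) :: ennreal) = indicator {u \<in> {0..1}. s < \<bar>h r u\<bar>} x"
        by (simp add: indicator_def)
    qed
    also have "(\<integral>\<^sup>+ x. indicator {u \<in> {0..1}. s < \<bar>h r u\<bar>} x \<partial>lborel) = distrib (h r) s"
      unfolding distrib_eq_lborel[OF h_borel] using h_borel by (intro nn_integral_indicator) simp
    finally show ?thesis by (simp add: ennreal_of_nat_eq_real_of_nat)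
  qed
  \<comment> \<open>A single piece is dominated by \<open>g\<close> itself, so the triangle
    inequality over the pieces costs exactly the factor \<open>D\<close>.\<close>
  have h: "h r \<in> E" "N (h r) \<le> N g" if r: "r < D" for r
  proof -
    have "distrib (h r) s \<le> distrib g s" if "s \<ge> 0" for s
    proof -
      have "of_nat D * distrib (h r) s \<le> of_nat D * distrib g s"
        using dist_h[OF that r] le[OF that] by simp
      then show ?thesis using D by (subst (asm) ennreal_mult_le_mult_iff) auto
    qed
    then show "h r \<in> E" "N (h r) \<le> N g"
      using mem_if_distrib_le[OF g h_borel] by blast+
  qed
  let ?H = "\<lambda>t. \<Sum>r<D. h r t"
  have H: "?H \<in> E \<and> N ?H \<le> (\<Sum>r<D. N (h r))" using h by (intro norm_sum_le) auto
  have H_borel: "?H \<in> borel_measurable borel" using h_borel by simp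
  have fH: "distrib f s \<le> distrib ?H s" if s: "s \<ge> 0" for s
  proof -
    let ?B = "\<lambda>r. {u \<in> {0..1}. s < \<bar>h r u\<bar>}"
    have BJ: "?B r \<subseteq> J r" for r using s by (auto simp: h_def indicator_def split: if_splits)
    have "of_nat D * distrib f s = (\<Sum>r<D. of_nat D * distrib (h r) s)"
      using dist_h[OF s] by simp
    also have "\<dots> = of_nat D * (\<Sum>r<D. distrib (h r) s)" by (simp add: sum_distrib_left)
    finally have "distrib f s = (\<Sum>r<D. distrib (h r) s)"
      using D by (subst (asm) ennreal_mult_cancel_left) auto
    also have "\<dots> = (\<Sum>r<D. emeasure lborel (?B r))"
      using h_borel by (simp add: distrib_eq_lborel)
    also have "\<dots> = emeasure lborel (\<Union>r<D. ?B r)"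
    proof (rule sum_emeasure)
      show "disjoint_family_on ?B {..<D}"
        using disj BJ unfolding disjoint_family_on_def by blast
    qed (use h_borel in auto)
    also have "\<dots> \<le> distrib ?H s"
      unfolding distrib_eq_lborel[OF H_borel]
    proof (rule emeasure_mono)
      show "(\<Union>r<D. ?B r) \<subseteq> {u \<in> {0..1}. s < \<bar>?H u\<bar>}"
      proof
        fix u assume "u \<in> (\<Union>r<D. ?B r)"
        then obtain r where r: "r < D" "u \<in> ?B r" by auto
        have "?H u = (\<Sum>r'<D. if r' = r then h r u else 0)"
          using BJ[of r] r disj
          by (intro sum.cong) (auto simp: h_def disjoint_family_on_def indicator_def)
        then show "u \<in> {u \<in> {0..1}. s < \<bar>?H u\<bar>}" using r by simp
      qed
    qed (use H_borel in simp)
    finally show ?thesis .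
  qed
  show "f \<in> E" using mem_if_distrib_le[OF conjunct1[OF H] f fH] by blast
  have "N f \<le> N ?H" using mem_if_distrib_le[OF conjunct1[OF H] f fH] by blast
  also have "\<dots> \<le> (\<Sum>r<D. N g)" using H h by (meson lessThan_iff order_trans sum_mono)
  finally show "N f \<le> D * N g" by simp
qed

text \<open>The average of \<open>v \<circ> \<pi>\<close> over all permutations \<open>\<pi>\<close> of the cells is the constant mean of \<open>v\<close>.\<close>

lemma mean_le_norm_step:
  fixes v :: "'k \<Rightarrow> real"
  assumes one: "(\<lambda>t. 1) \<in> E" "N (\<lambda>t. 1) = 1"
    and K: "finite K" "card K = n" "n > 0" and I: "\<And>k. k \<in> K \<Longrightarrow> I k \<in> sets borel"
    "\<And>k. k \<in> K \<Longrightarrow> I k \<subseteq> {0..1}" "\<And>k. k \<in> K \<Longrightarrow> emeasure lborel (I k) = ennreal (1 / n)"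
    and disj: "disjoint_family_on I K" and v: "\<And>k. k \<in> K \<Longrightarrow> v k \<ge> 0"
    and mem: "(\<lambda>t. \<Sum>k\<in>K. v k * indicator (I k) t) \<in> E"
  shows "(\<Sum>k\<in>K. v k) / n \<le> N (\<lambda>t. \<Sum>k\<in>K. v k * indicator (I k) t)"
proof -
  let ?f = "\<lambda>\<pi> t. \<Sum>k\<in>K. v (\<pi> k) * indicator (I k) t"
  let ?P = "{\<pi>. \<pi> permutes K}" and ?c = "fact (n - 1) * (\<Sum>k\<in>K. v k)"
  have dist: "distrib (\<lambda>t. \<Sum>k\<in>K. w k * indicator (I k) t) s
      = ennreal (card {k \<in> K. s < \<bar>w k\<bar>} / n)" if "s \<ge> 0" for w s
    using K I disj that by (intro distrib_step) auto
  have borel: "(\<lambda>t. \<Sum>k\<in>K. w k * indicator (I k) t) \<in> borel_measurable borel" for w :: "'k \<Rightarrow> real"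
    using I(1) by (intro borel_measurable_sum borel_measurable_times borel_measurable_indicator) auto
  \<comment> \<open>Permuting values among cells of equal length preserves the distribution
    function.\<close>
  have f: "?f \<pi> \<in> E" "N (?f \<pi>) \<le> N (?f id)" if \<pi>: "\<pi> permutes K" for \<pi>
  proof -
    have "card {k \<in> K. s < \<bar>v (\<pi> k)\<bar>} = card {k \<in> K. s < \<bar>v k\<bar>}" for s
    proof (rule bij_betw_same_card[of \<pi>])
      show "bij_betw \<pi> {k \<in> K. s < \<bar>v (\<pi> k)\<bar>} {k \<in> K. s < \<bar>v k\<bar>}"
        using \<pi> permutes_in_image[OF \<pi>] permutes_surj[OF \<pi>]
        by (auto simp: bij_betw_def image_iff permutes_inj_on[OF \<pi>] surj_def) metis
    qed
    then have "distrib (?f \<pi>) s \<le> distrib (?f id) s" if "s \<ge> 0" for s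
      using that by (simp only: dist) simp
    then show "?f \<pi> \<in> E" "N (?f \<pi>) \<le> N (?f id)"
      using mem_if_distrib_le[OF _ borel, of "?f id"] mem by auto
  qed
  have "(\<lambda>t. \<Sum>\<pi>\<in>?P. ?f \<pi> t) = (\<lambda>t. \<Sum>k\<in>K. ?c * indicator (I k) t)"
  proof
    fix t
    have "(\<Sum>\<pi>\<in>?P. ?f \<pi> t) = (\<Sum>k\<in>K. (\<Sum>\<pi>\<in>?P. v (\<pi> k)) * indicator (I k) t)"
      by (subst sum.swap) (simp add: sum_distrib_right)
    also have "\<dots> = (\<Sum>k\<in>K. ?c * indicator (I k) t)"
      using sum_permutes_single[of K _ "\<lambda>_. v"] K by simp
    finally show "(\<Sum>\<pi>\<in>?P. ?f \<pi> t) = (\<Sum>k\<in>K. ?c * indicator (I k) t)" .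
  qed
  moreover have "(\<lambda>t. \<Sum>\<pi>\<in>?P. ?f \<pi> t) \<in> E \<and> N (\<lambda>t. \<Sum>\<pi>\<in>?P. ?f \<pi> t) \<le> (\<Sum>\<pi>\<in>?P. N (?f \<pi>))"
    using f K by (intro norm_sum_le) (auto simp: finite_permutations)
  moreover have "(\<Sum>\<pi>\<in>?P. N (?f \<pi>)) \<le> (\<Sum>\<pi>\<in>?P. N (?f id))" using f by (intro sum_mono) auto
  moreover have "\<dots> = fact n * N (?f id)" using K by (simp add: card_permutations)
  ultimately have cE: "(\<lambda>t. \<Sum>k\<in>K. ?c * indicator (I k) t) \<in> E"
    and cN: "N (\<lambda>t. \<Sum>k\<in>K. ?c * indicator (I k) t) \<le> fact n * N (?f id)" by auto
  have c0: "?c \<ge> 0" using v by (intro mult_nonneg_nonneg sum_nonneg) auto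
  \<comment> \<open>The \<open>n\<close> cells have total measure 1, so they miss only a null set of
    the unit interval.\<close>
  have "distrib (\<lambda>t. ?c) s \<le> distrib (\<lambda>t. \<Sum>k\<in>K. ?c * indicator (I k) t) s" if s: "s \<ge> 0" for s
  proof (cases "s < ?c")
    case True
    then have "{k \<in> K. s < \<bar>?c\<bar>} = K" by auto
    then show ?thesis unfolding dist[OF s] using distrib_le_1[of "\<lambda>t. ?c" s] K by simp
  next
    case False
    then have "distrib (\<lambda>t. ?c) s = 0" using c0 by (simp add: distrib_def)
    then show ?thesis by simp
  qed
  then have "N (\<lambda>t. ?c) \<le> N (\<lambda>t. \<Sum>k\<in>K. ?c * indicator (I k) t)"
    by (intro mem_if_distrib_le[OF cE]) auto
  with cN have "?c \<le> fact n * N (?f id)" using norm_scale[OF one(1), of ?c] one c0 by simp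
  moreover have "fact n = real n * fact (n - 1)" using K by (simp add: fact_reduce)
  ultimately show ?thesis using K by (simp add: field_simps)
qed

end

section \<open>The distribution of the diagonal norm\<close>

lemma powr_le_self:
  fixes a q :: real
  assumes "0 \<le> a" "a \<le> 1" "1 \<le> q"
  shows "a powr q \<le> a"
  using assms powr_le_one_le[of a q] by (cases "a = 0") auto

text \<open>After division by \<open>a + b\<close> both terms lie in [0,1], where the power
  \<open>q \<ge> 1\<close> only decreases them.\<close>

lemma powr_add_powr_le:
  fixes a b q :: real
  assumes "a \<ge> 0" "b \<ge> 0" "q \<ge> 1"
  shows "a powr q + b powr q \<le> (a + b) powr q"
proof (cases "a + b = 0")
  case True
  then show ?thesis using assms by (simp add: add_nonneg_eq_0_iff)
next
  case False
  then have s: "a + b > 0" using assms by linarith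
  have "(a / (a + b)) powr q + (b / (a + b)) powr q \<le> a / (a + b) + b / (a + b)"
    using s assms by (intro add_mono powr_le_self) auto
  also have "\<dots> = 1" using s by (simp add: add_divide_distrib[symmetric])
  finally show ?thesis using s assms by (simp add: powr_divide add_divide_distrib[symmetric])
qed

lemma exp_minus_one_le:
  fixes z :: real
  assumes "0 \<le> z" "z \<le> 1"
  shows "exp z - 1 \<le> 2 * z"
proof -
  have "z\<^sup>2 \<le> z" using assms by (simp add: power2_eq_square mult_left_le)
  then show ?thesis using exp_bound[OF assms] by simp
qed

text \<open>Sorting the positions by \<open>sort_key\<close> instead of the values remembers where
  each rearranged entry sits, so that one can ask whether a diagonal meets the k-th largest
  entry.\<close>

lemma matrix_rearr_enumeration:
  obtains pos where "bij_betw pos {1..n\<^sup>2} ({1..n} \<times> {1..n})"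
    and "\<And>k. k \<in> {1..n\<^sup>2} \<Longrightarrow> matrix_rearr n x k = \<bar>x (fst (pos k)) (snd (pos k))\<bar>"
    and "\<And>j k. 1 \<le> j \<Longrightarrow> j \<le> k \<Longrightarrow> k \<le> n\<^sup>2 \<Longrightarrow> matrix_rearr n x k \<le> matrix_rearr n x j"
proof -
  define P where "P = List.product [1..<Suc n] [1..<Suc n]"
  define g where "g = (\<lambda>p. \<bar>x (fst p) (snd p)\<bar>)"
  define L where "L = rev (sort_key g P)"
  have ent: "[\<bar>x i j\<bar>. i \<leftarrow> [1..<Suc n], j \<leftarrow> [1..<Suc n]] = map g P"
    by (simp add: P_def g_def product_concat_map map_concat o_def)
  have "sort (map g P) = map g (sort_key g P)"
    by (rule properties_for_sort) auto
  then have rearr: "matrix_rearr n x k = map g L ! (k - 1)" for k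
    unfolding matrix_rearr_def ent by (simp add: L_def rev_map)
  have len: "length L = n\<^sup>2" by (simp add: L_def P_def power2_eq_square del: upt_Suc)
  have dist: "distinct L" by (simp add: L_def P_def distinct_product del: upt_Suc)
  have set: "set L = {1..n} \<times> {1..n}"
    by (auto simp: L_def P_def simp del: upt_Suc)
  show thesis
  proof
    have "bij_betw (\<lambda>k. k - 1) {1..n\<^sup>2} {..<n\<^sup>2}"
      by (rule bij_betwI[of _ _ _ Suc]) auto
    moreover have "bij_betw ((!) L) {..<n\<^sup>2} ({1..n} \<times> {1..n})"
      using dist len set by (intro bij_betw_nth) auto
    ultimately show "bij_betw ((!) L \<circ> (\<lambda>k. k - 1)) {1..n\<^sup>2} ({1..n} \<times> {1..n})"
      by (rule bij_betw_trans)
    show "matrix_rearr n x k = \<bar>x (fst (((!) L \<circ> (\<lambda>k. k - 1)) k)) (snd (((!) L \<circ> (\<lambda>k. k - 1)) k))\<bar>"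
      if "k \<in> {1..n\<^sup>2}" for k
      using that len unfolding rearr by (subst nth_map) (auto simp: g_def)
    show "matrix_rearr n x k \<le> matrix_rearr n x j" if "1 \<le> j" "j \<le> k" "k \<le> n\<^sup>2" for j k
    proof -
      have "sorted (rev (map g L))" by (simp add: L_def rev_map)
      then show ?thesis
        using sorted_rev_nth_mono[of "map g L" "j - 1" "k - 1"] that len unfolding rearr by auto
    qed
  qed
qed

locale enumerated_matrix =
  fixes n :: nat and x :: "nat \<Rightarrow> nat \<Rightarrow> real" and pos :: "nat \<Rightarrow> nat \<times> nat" and w :: "nat \<Rightarrow> real"
    and q :: real
  assumes n: "n \<ge> 1" and q: "q \<ge> 1"
    and pos: "bij_betw pos {1..n\<^sup>2} ({1..n} \<times> {1..n})"
    and w_pos: "\<And>k. k \<in> {1..n\<^sup>2} \<Longrightarrow> w k = \<bar>x (fst (pos k)) (snd (pos k))\<bar>"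
    and w_mono: "\<And>j k. 1 \<le> j \<Longrightarrow> j \<le> k \<Longrightarrow> k \<le> n\<^sup>2 \<Longrightarrow> w k \<le> w j"
begin

definition diag_norm :: "(nat \<Rightarrow> nat) \<Rightarrow> real" where
  "diag_norm \<pi> = (\<Sum>i=1..n. \<bar>x i (\<pi> i)\<bar> powr q) powr (1 / q)"

text \<open>Selection is by rank, so ties do not disturb the counting. The constant 1 for
  \<open>\<phi>\<close> counts hits of a diagonal, and a power gives partial
  \<open>q\<close>-sums.\<close>

definition entries :: "nat set \<Rightarrow> (real \<Rightarrow> real) \<Rightarrow> nat \<Rightarrow> nat \<Rightarrow> real" where
  "entries A \<phi> i j = (if (i, j) \<in> pos ` A then \<phi> \<bar>x i j\<bar> else 0)"

lemma n_le_square: "n \<le> n\<^sup>2"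
  using n by (simp add: power2_eq_square)

lemma w_nonneg: "k \<in> {1..n\<^sup>2} \<Longrightarrow> w k \<ge> 0"
  using w_pos by simp

lemma entry_eq:
  assumes "(i, j) = pos k" "k \<in> {1..n\<^sup>2}"
  shows "\<bar>x i j\<bar> = w k"
  using w_pos[OF assms(2)] assms(1)[symmetric] by simp

lemma sum_entries:
  assumes "A \<subseteq> {1..n\<^sup>2}"
  shows "(\<Sum>i=1..n. \<Sum>j=1..n. entries A \<phi> i j) = (\<Sum>k\<in>A. \<phi> (w k))"
proof -
  have "(\<Sum>i=1..n. \<Sum>j=1..n. entries A \<phi> i j) = (\<Sum>(i, j)\<in>{1..n} \<times> {1..n}. entries A \<phi> i j)"
    by (rule sum.cartesian_product)
  also have "\<dots> = (\<Sum>k=1..n\<^sup>2. case pos k of (i, j) \<Rightarrow> entries A \<phi> i j)"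
    by (rule sum.reindex_bij_betw[OF pos, symmetric])
  also have "\<dots> = (\<Sum>k=1..n\<^sup>2. if k \<in> A then \<phi> (w k) else 0)"
  proof (rule sum.cong[OF refl])
    fix k assume k: "k \<in> {1..n\<^sup>2}"
    have "pos k \<in> pos ` A \<longleftrightarrow> k \<in> A"
      using inj_on_image_mem_iff[OF bij_betw_imp_inj_on[OF pos] k assms] .
    then show "(case pos k of (i, j) \<Rightarrow> entries A \<phi> i j) = (if k \<in> A then \<phi> (w k) else 0)"
      using w_pos[OF k] by (auto simp: entries_def split: prod.split)
  qed
  also have "\<dots> = (\<Sum>k\<in>{1..n\<^sup>2} \<inter> A. \<phi> (w k))" by (simp add: sum.inter_restrict)
  also have "{1..n\<^sup>2} \<inter> A = A" using assms by auto
  finally show ?thesis .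
qed

lemma le_diag_norm:
  assumes "0 \<le> y" "y powr q \<le> (\<Sum>i=1..n. \<bar>x i (\<pi> i)\<bar> powr q)"
  shows "y \<le> diag_norm \<pi>"
proof -
  have "y = (y powr q) powr (1 / q)" using assms q by (simp add: powr_powr)
  also have "\<dots> \<le> diag_norm \<pi>" unfolding diag_norm_def using assms q by (intro powr_mono2) auto
  finally show ?thesis .
qed

lemma diag_norm_le:
  assumes "0 \<le> y" "(\<Sum>i=1..n. \<bar>x i (\<pi> i)\<bar> powr q) \<le> y powr q"
  shows "diag_norm \<pi> \<le> y"
proof -
  have "diag_norm \<pi> \<le> (y powr q) powr (1 / q)"
    unfolding diag_norm_def using assms q by (intro powr_mono2 sum_nonneg) auto
  also have "\<dots> = y" using assms q by (simp add: powr_powr)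
  finally show ?thesis .
qed

section \<open>Lower bounds for the distribution of the diagonal norm\<close>

text \<open>Paley-Zygmund for the number of hits of the entries exceeding \<open>s\<close> among the
  first \<open>n\<close> ranks: entries are at most 1 and the mean is m <= 1, so the probability is
  at least m/(4(1 + 2m)) >= m/12. A single hit already forces the norm above
  \<open>s\<close>.\<close>

lemma card_diag_norm_gt_lower:
  assumes s: "s \<ge> 0"
  shows "real (card {k \<in> {1..n}. s < w k}) / n * fact n
    \<le> 12 * real (card {\<pi>. \<pi> permutes {1..n} \<and> s < diag_norm \<pi>})"
proof -
  let ?A = "{k \<in> {1..n}. s < w k}"
  show ?thesis
  proof (cases "card ?A = 0")
    case True
    then show ?thesis by (simp only:)
  next
    case False
    define m where "m = real (card ?A) / n"
    let ?a = "entries ?A (\<lambda>_. 1)"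
    have A: "?A \<subseteq> {1..n\<^sup>2}" using n_le_square by auto
    have "card ?A \<le> card {1..n}" by (rule card_mono) auto
    then have "real (card ?A) \<le> n" "0 < real (card ?A)"
      using False by (simp_all only: card_atLeastAtMost diff_Suc_1 of_nat_le_iff of_nat_0_less_iff neq0_conv)
    then have m: "m > 0" "m \<le> 1"
      unfolding m_def by (simp_all only: divide_pos_pos divide_le_eq_1_pos order_less_le_trans)
    have "m / 12 * fact n \<le> m / (4 * (1 + 2 * m)) * fact n"
      using m by (intro mult_right_mono divide_left_mono) auto
    also have "\<dots> \<le> real (card {\<pi>. \<pi> permutes {1..n} \<and> (\<Sum>i=1..n. ?a i (\<pi> i)) \<ge> m / 2})"
      by (rule card_permutes_sum_ge_half_mean[OF n])
         (use m sum_entries[OF A, of "\<lambda>_. 1"] in \<open>auto simp: entries_def m_def\<close>)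
    also have "\<dots> \<le> real (card {\<pi>. \<pi> permutes {1..n} \<and> s < diag_norm \<pi>})"
    proof (intro of_nat_mono card_mono subsetI)
      fix \<pi> assume "\<pi> \<in> {\<pi>. \<pi> permutes {1..n} \<and> (\<Sum>i=1..n. ?a i (\<pi> i)) \<ge> m / 2}"
      then have \<pi>: "\<pi> permutes {1..n}" and "(\<Sum>i=1..n. ?a i (\<pi> i)) > 0" using m by auto
      then obtain i where i: "i \<in> {1..n}" "?a i (\<pi> i) \<noteq> 0"
        by (metis (no_types, lifting) less_irrefl sum.neutral)
      then obtain k where k: "(i, \<pi> i) = pos k" "k \<in> ?A" by (auto simp: entries_def split: if_splits)
      have "s < w k" using k by simp
      also have "w k \<le> diag_norm \<pi>"
      proof (rule le_diag_norm)
        have "w k = \<bar>x i (\<pi> i)\<bar>" using entry_eq[OF k(1)] A k(2) by auto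
        then show "0 \<le> w k" "w k powr q \<le> (\<Sum>i=1..n. \<bar>x i (\<pi> i)\<bar> powr q)"
          using i member_le_sum[of i "{1..n}" "\<lambda>i. \<bar>x i (\<pi> i)\<bar> powr q"] by auto
      qed
      finally show "\<pi> \<in> {\<pi>. \<pi> permutes {1..n} \<and> s < diag_norm \<pi>}" using \<pi> by simp
    qed (simp add: finite_permutations)
    finally have "m * fact n \<le> 12 * real (card {\<pi>. \<pi> permutes {1..n} \<and> s < diag_norm \<pi>})"
      by linarith
    then show ?thesis unfolding m_def .
  qed
qed

text \<open>Beyond rank \<open>n\<close> the entries of the \<open>q\<close>-sum are at most M =
  \<open>w n powr q\<close> < \<open>m\<close>, so the Paley-Zygmund ratio m/(4(M + 2m)) is at least
  1/12.\<close>

lemma card_diag_norm_ge_tail: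
  fixes m :: real
  assumes m: "m = (\<Sum>k=n+1..n\<^sup>2. w k powr q) / n" "w n powr q < m"
  shows "fact n \<le> 12 * real (card {\<pi>. \<pi> permutes {1..n} \<and> (m / 2) powr (1 / q) \<le> diag_norm \<pi>})"
proof -
  let ?A = "{n+1..n\<^sup>2}" and ?M = "w n powr q"
  let ?a = "entries ?A (\<lambda>z. z powr q)"
  have A: "?A \<subseteq> {1..n\<^sup>2}" by auto
  have m0: "m > 0" using m(2) powr_ge_zero[of "w n" q] by linarith
  have "1 / 12 \<le> m / (4 * (M + 2 * m))" if "0 \<le> M" "M < m" for M
  proof -
    have "4 * (M + 2 * m) > 0" "4 * (M + 2 * m) \<le> 12 * m" using that by auto
    then show ?thesis by (simp add: field_simps)
  qed
  from this[OF powr_ge_zero m(2)] have "1 / 12 \<le> m / (4 * (?M + 2 * m))" .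
  then have "1 / 12 * fact n \<le> m / (4 * (?M + 2 * m)) * fact n" by (intro mult_right_mono) auto
  also have "\<dots> \<le> real (card {\<pi>. \<pi> permutes {1..n} \<and> (\<Sum>i=1..n. ?a i (\<pi> i)) \<ge> m / 2})"
  proof (rule card_permutes_sum_ge_half_mean[OF n])
    fix i j
    show "?a i j \<ge> 0" by (simp add: entries_def)
    show "?a i j \<le> ?M"
    proof (cases "(i, j) \<in> pos ` ?A")
      case True
      then obtain k where k: "(i, j) = pos k" "k \<in> ?A" by auto
      have "\<bar>x i j\<bar> = w k" using entry_eq[OF k(1)] k(2) by auto
      moreover have "w k \<le> w n" using k n by (intro w_mono) auto
      ultimately show ?thesis using True q by (auto simp: entries_def intro!: powr_mono2)
    qed (simp add: entries_def)
  qed (use m m0 sum_entries[OF A, of "\<lambda>z. z powr q"] in auto)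
  also have "\<dots> \<le> real (card {\<pi>. \<pi> permutes {1..n} \<and> (m / 2) powr (1 / q) \<le> diag_norm \<pi>})"
  proof (intro of_nat_mono card_mono subsetI)
    fix \<pi> assume "\<pi> \<in> {\<pi>. \<pi> permutes {1..n} \<and> (\<Sum>i=1..n. ?a i (\<pi> i)) \<ge> m / 2}"
    then have \<pi>: "\<pi> permutes {1..n}" and ge: "m / 2 \<le> (\<Sum>i=1..n. ?a i (\<pi> i))" by auto
    have "(m / 2) powr (1 / q) \<le> diag_norm \<pi>"
      unfolding diag_norm_def
    proof (rule powr_mono2)
      show "m / 2 \<le> (\<Sum>i=1..n. \<bar>x i (\<pi> i)\<bar> powr q)"
        by (rule order_trans[OF ge], rule sum_mono) (simp add: entries_def)
    qed (use q m0 in auto)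
    then show "\<pi> \<in> {\<pi>. \<pi> permutes {1..n} \<and> (m / 2) powr (1 / q) \<le> diag_norm \<pi>}" using \<pi> by simp
  qed (simp add: finite_permutations)
  finally show ?thesis by simp
qed

end

section \<open>Upper bound for the distribution of the diagonal norm\<close>

context enumerated_matrix
begin

text \<open>Outside three events of probability \<open>O(t)\<close>, the diagonal avoids the first \<open>k - 1\<close> entries,
  meets at most \<open>J\<close> of the entries number \<open>k, \<dots>, n\<close> exceeding \<open>t\<^sup>-\<^sup>\<epsilon> R\<close> (there are at most
  \<open>n t\<^sup>\<epsilon>\<close> of these), and the remaining entries have a \<open>q\<close>-sum with exponential moments of scale
  \<open>(t\<^sup>-\<^sup>\<epsilon> R)\<^sup>q\<close>.\<close>

lemma card_diag_norm_gt_upper: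
  fixes J :: nat and t \<epsilon> R :: real
  assumes t: "0 < t" "t < 1" and \<epsilon>: "0 < \<epsilon>" "\<epsilon> \<le> 1" and J: "1 \<le> \<epsilon> * J" and R: "R > 0"
    and head: "(\<Sum>k=1..n. w k) / n \<le> R"
    and tail: "(\<Sum>k=n+1..n\<^sup>2. w k powr q) / n \<le> R powr q"
    and k: "k = nat \<lceil>n * t\<rceil>"
  shows "real (card {\<pi>. \<pi> permutes {1..n} \<and> J * w k + R / \<epsilon> * t powr (- (2 * \<epsilon>)) < diag_norm \<pi>})
    \<le> (1 + exp (exp 1) + exp (4 * exp 1)) * t * fact n"
proof -
  define c where "c = t powr (- \<epsilon>)"
  define Mid where "Mid = {j \<in> {k..n}. c * R < w j}"
  define Low where "Low = {k..n\<^sup>2} - Mid"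
  \<comment> \<open>Dividing by \<open>L\<close> puts the low entries into [0,1], where exp z - 1 <=
    2 z.\<close>
  define L where "L = (c * R) powr q"
  let ?big = "entries {1..<k} (\<lambda>_. 1)" and ?mid = "entries Mid (\<lambda>_. ln c)"
    and ?low = "entries Low (\<lambda>z. z powr q / L)"
  let ?S = "\<lambda>a \<pi>. \<Sum>i=1..n. a i (\<pi> i) :: real"
  have nt: "0 < n * t" "n * t < n" using n t by auto
  have k1: "1 \<le> k" "k \<le> n" using nt unfolding k by linarith+
  have knt: "real k - 1 \<le> n * t" using nt unfolding k by linarith
  have sub: "{1..<k} \<subseteq> {1..n\<^sup>2}" "Mid \<subseteq> {1..n\<^sup>2}" "Low \<subseteq> {1..n\<^sup>2}"
    using k1 n_le_square by (auto simp: Mid_def Low_def)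
  have c1: "c > 1" unfolding c_def using t \<epsilon> mult_pos_neg[of \<epsilon> "ln t"] by (simp add: powr_def)
  have ln_c: "ln c = - \<epsilon> * ln t" "ln c > 0" using t ln_gt_zero[OF c1] by (simp_all add: c_def ln_powr)
  have cR: "c * R > 0" and L: "L > 0" using c1 R by (auto simp: L_def)
  have ln_t: "ln t < 0" using t by simp
  have w0: "w j \<ge> 0" if "j \<in> {1..n\<^sup>2}" for j using w_nonneg[OF that] .
  have sumw: "(\<Sum>j=1..n. w j) \<le> n * R" using head n by (simp add: field_simps)
  \<comment> \<open>The least of the first \<open>n\<close> values is below their mean. As
    \<open>c > 1\<close>, no rank beyond \<open>n\<close> exceeds the threshold
    \<open>c * R\<close>.\<close>
  have wn: "w n \<le> R"
  proof -
    have "n * w n \<le> (\<Sum>j=1..n. w j)"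
      using sum_mono[of "{1..n}" "\<lambda>_. w n" w] w_mono n_le_square by simp
    then have "n * w n \<le> n * R" using sumw by linarith
    then show ?thesis using n by simp
  qed
  have low_le: "w j \<le> c * R" if "j \<in> Low" for j
  proof (cases "j \<le> n")
    case True
    then show ?thesis using that by (auto simp: Low_def Mid_def)
  next
    case False
    then have "w j \<le> w n" using that n by (intro w_mono) (auto simp: Low_def)
    also have "\<dots> \<le> R" by (rule wn)
    also have "R \<le> c * R" using c1 R by simp
    finally show ?thesis .
  qed

  \<comment> \<open>The expected number of hits among the first \<open>k - 1\<close> ranks is (k -
    1)/n <= t, by the choice of \<open>k\<close> as a ceiling.\<close>
  have big: "real (card {\<pi>. \<pi> permutes {1..n} \<and> 1 \<le> ?S ?big \<pi>}) \<le> t * fact n"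
  proof -
    have "real (card {\<pi> \<in> {\<pi>. \<pi> permutes {1..n}}. 1 \<le> ?S ?big \<pi>}) * 1
        \<le> (\<Sum>\<pi> | \<pi> permutes {1..n}. ?S ?big \<pi>)"
      by (rule card_mult_le_sum) (auto simp: finite_permutations entries_def intro!: sum_nonneg)
    also have "\<dots> = fact (n - 1) * (real k - 1)"
      unfolding sum_permutes_sum sum_entries[OF sub(1)] using k1 by (simp add: of_nat_diff)
    also have "\<dots> \<le> fact (n - 1) * (n * t)" using knt by (intro mult_left_mono) auto
    also have "\<dots> = t * fact n" using n by (simp add: fact_reduce)
    finally show ?thesis by simp
  qed

  \<comment> \<open>Weighting each hit by \<open>ln c\<close> balances the bound n/c for the size of
    \<open>Mid\<close>: the Chernoff exponent is at most e, and \<open>J\<close> hits have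
    probability at most e^e c^(-J) <= e^e t because \<open>1 \<le> \<epsilon> * J\<close>.\<close>
  have mid: "real (card {\<pi>. \<pi> permutes {1..n} \<and> J * ln c \<le> ?S ?mid \<pi>}) \<le> exp (exp 1) * t * fact n"
  proof -
    have mid0: "?mid i j \<ge> 0" for i j using ln_c(2) by (simp add: entries_def)
    have "card Mid * (c * R) \<le> (\<Sum>j\<in>Mid. w j)"
      using sum_mono[of Mid "\<lambda>_. c * R" w] by (auto simp: Mid_def)
    also have "\<dots> \<le> (\<Sum>j=1..n. w j)"
      using k1 w0 n_le_square by (intro sum_mono2) (auto simp: Mid_def)
    finally have "card Mid * c * R \<le> n * R" using sumw by (simp add: mult.assoc)
    then have "card Mid * c \<le> n" using R by simp
    moreover have "(\<Sum>i=1..n. \<Sum>j=1..n. exp (?mid i j) - 1) = card Mid * (c - 1)"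
    proof -
      have "(\<Sum>i=1..n. \<Sum>j=1..n. exp (?mid i j) - 1) = (\<Sum>i=1..n. \<Sum>j=1..n. entries Mid (\<lambda>_. c - 1) i j)"
        using c1 by (intro sum.cong) (auto simp: entries_def)
      then show ?thesis using sum_entries[OF sub(2)] by simp
    qed
    ultimately have "exp 1 / n * (\<Sum>i=1..n. \<Sum>j=1..n. exp (?mid i j) - 1) \<le> exp 1 / n * n"
      by (intro mult_left_mono) (auto simp: algebra_simps)
    also have "\<dots> = exp 1" using n by simp
    finally have e: "exp 1 / n * (\<Sum>i=1..n. \<Sum>j=1..n. exp (?mid i j) - 1) \<le> exp 1" .
    have "J * ln c = (\<epsilon> * J) * (- ln t)" using ln_c by simp
    also have "\<dots> \<ge> 1 * (- ln t)" using J ln_t by (intro mult_right_mono) auto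
    finally have "- ln t \<le> J * ln c" by simp
    with e have "exp 1 / n * (\<Sum>i=1..n. \<Sum>j=1..n. exp (?mid i j) - 1) - J * ln c \<le> exp 1 + ln t"
      by linarith
    then have "fact n * exp (exp 1 / n * (\<Sum>i=1..n. \<Sum>j=1..n. exp (?mid i j) - 1) - J * ln c)
        \<le> fact n * exp (exp 1 + ln t)" by simp
    also have "\<dots> = exp (exp 1) * t * fact n" using t by (simp add: exp_add)
    finally show ?thesis
      by (rule order_trans[OF card_permutes_sum_ge_exp[OF n mid0]])
  qed

  \<comment> \<open>Ranks up to \<open>n\<close> contribute at most \<open>n\<close> by
    \<open>head\<close>, later ranks at most \<open>n\<close> by \<open>tail\<close>. With exp z - 1
    <= 2 z this gives the exponent 4e.\<close>
  have low: "real (card {\<pi>. \<pi> permutes {1..n} \<and> - ln t \<le> ?S ?low \<pi>}) \<le> exp (4 * exp 1) * t * fact n"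
  proof -
    have "(\<Sum>j\<in>Low. w j powr q / L) \<le> (\<Sum>j\<in>Low \<inter> {1..n}. w j powr q / L) + (\<Sum>j=n+1..n\<^sup>2. w j powr q / L)"
    proof -
      have "(\<Sum>j\<in>Low. w j powr q / L) \<le> (\<Sum>j\<in>(Low \<inter> {1..n}) \<union> {n+1..n\<^sup>2}. w j powr q / L)"
        using sub L by (intro sum_mono2) auto
      also have "\<dots> = (\<Sum>j\<in>Low \<inter> {1..n}. w j powr q / L) + (\<Sum>j=n+1..n\<^sup>2. w j powr q / L)"
        by (intro sum.union_disjoint) auto
      finally show ?thesis .
    qed
    also have "(\<Sum>j\<in>Low \<inter> {1..n}. w j powr q / L) \<le> (\<Sum>j\<in>Low \<inter> {1..n}. w j / R)"
    proof (rule sum_mono)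
      fix j assume j: "j \<in> Low \<inter> {1..n}"
      then have wj: "w j \<ge> 0" using w0 sub by auto
      have "w j powr q / L = (w j / (c * R)) powr q" using wj cR by (simp add: L_def powr_divide)
      also have "\<dots> \<le> w j / (c * R)" using wj cR low_le j q by (intro powr_le_self) auto
      also have "\<dots> \<le> w j / R" using wj c1 R by (intro divide_left_mono) auto
      finally show "w j powr q / L \<le> w j / R" .
    qed
    also have "\<dots> \<le> (\<Sum>j=1..n. w j / R)" using w0 n_le_square R by (intro sum_mono2) auto
    also have "\<dots> \<le> n" using sumw R by (simp add: sum_divide_distrib[symmetric] field_simps)
    also have "(\<Sum>j=n+1..n\<^sup>2. w j powr q / L) \<le> n"
    proof -
      have "R powr q \<le> L" unfolding L_def using c1 R q by (intro powr_mono2) auto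
      then have "n * R powr q \<le> n * L" by (intro mult_left_mono) auto
      moreover have "(\<Sum>j=n+1..n\<^sup>2. w j powr q) \<le> n * R powr q"
        using tail n by (simp add: field_simps)
      ultimately show ?thesis using L by (simp add: sum_divide_distrib[symmetric] field_simps)
    qed
    finally have sum_le: "(\<Sum>j\<in>Low. w j powr q / L) \<le> 2 * n" by simp
    have le1: "?low i j \<le> 1" for i j
    proof (cases "(i, j) \<in> pos ` Low")
      case True
      then obtain l where l: "(i, j) = pos l" "l \<in> Low" by auto
      have "\<bar>x i j\<bar> = w l" using entry_eq[OF l(1)] l(2) sub by auto
      then have "\<bar>x i j\<bar> powr q \<le> L" unfolding L_def using low_le[OF l(2)] q by (intro powr_mono2) auto
      then show ?thesis using L by (simp add: entries_def)
    qed (simp add: entries_def)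
    have ge0: "?low i j \<ge> 0" for i j using L by (simp add: entries_def)
    have "exp 1 / n * (\<Sum>i=1..n. \<Sum>j=1..n. exp (?low i j) - 1)
        \<le> exp 1 / n * (\<Sum>i=1..n. \<Sum>j=1..n. 2 * ?low i j)"
      by (intro mult_left_mono sum_mono exp_minus_one_le ge0 le1) auto
    also have "\<dots> = exp 1 / n * (2 * (\<Sum>j\<in>Low. w j powr q / L))"
      using sum_entries[OF sub(3)] by (simp add: sum_distrib_left[symmetric])
    also have "\<dots> \<le> exp 1 / n * (2 * (2 * n))" using sum_le by (intro mult_left_mono) auto
    also have "\<dots> = 4 * exp 1" using n by simp
    finally have "fact n * exp (exp 1 / n * (\<Sum>i=1..n. \<Sum>j=1..n. exp (?low i j) - 1) - (- ln t))
        \<le> fact n * exp (4 * exp 1 + ln t)" by simp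
    also have "\<dots> = exp (4 * exp 1) * t * fact n" using t by (simp add: exp_add)
    finally show ?thesis
      by (rule order_trans[OF card_permutes_sum_ge_exp[OF n ge0]])
  qed

  have good: "diag_norm \<pi> \<le> J * w k + R / \<epsilon> * t powr (- (2 * \<epsilon>))"
    if \<pi>: "\<pi> permutes {1..n}" and nb: "?S ?big \<pi> < 1" and nm: "?S ?mid \<pi> < J * ln c"
      and nl: "?S ?low \<pi> < - ln t" for \<pi>
  proof -
    define h where "h = {i \<in> {1..n}. (i, \<pi> i) \<in> pos ` Mid}"
    have h: "{1..n} \<inter> h = h" by (auto simp: h_def)
    \<comment> \<open>The logarithm ln(1/t) is absorbed into a second factor \<open>c\<close>,
      whence the exponent \<open>2 * \<epsilon>\<close> in the claim.\<close>
    define B where "B = c / \<epsilon>"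
    have B: "B \<ge> 1" "- ln t \<le> B"
    proof -
      show "B \<ge> 1" using c1 \<epsilon> by (simp add: B_def field_simps)
      have "ln (1 / t) \<le> (1 / t) powr \<epsilon> / \<epsilon>" using t \<epsilon> by (intro ln_powr_bound) auto
      also have "(1 / t) powr \<epsilon> = c" using t by (simp add: c_def powr_minus powr_divide inverse_eq_divide)
      finally show "- ln t \<le> B" using t by (simp add: B_def ln_div)
    qed
    have wk: "w k \<ge> 0" using w0 k1 n_le_square by auto
    have J1: "real J \<ge> 1"
    proof (rule ccontr)
      assume "\<not> real J \<ge> 1"
      then have "J = 0" by simp
      then show False using J by simp
    qed
    have "?S ?mid \<pi> = (\<Sum>i\<in>h. ln c)" unfolding entries_def h_def by (rule sum.inter_filter[symmetric]) simp
    then have "card h * ln c < J * ln c" using nm by simp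
    then have ch: "real (card h) \<le> J"
      using mult_right_less_imp_less[of "real (card h)" "ln c" "real J"] ln_c(2) by simp
    have entry_le: "\<bar>x i (\<pi> i)\<bar> powr q \<le> (if i \<in> h then w k powr q else 0) + L * ?low i (\<pi> i)"
      if i: "i \<in> {1..n}" for i
    proof -
      have "(i, \<pi> i) \<in> pos ` {1..n\<^sup>2}"
        using i permutes_in_image[OF \<pi>] bij_betw_imp_surj_on[OF pos] by auto
      then obtain j where j: "(i, \<pi> i) = pos j" "j \<in> {1..n\<^sup>2}" by auto
      have jk: "k \<le> j"
      proof (rule ccontr)
        assume "\<not> k \<le> j"
        then have "?big i (\<pi> i) = 1" using j by (auto simp: entries_def)
        moreover have "?big i (\<pi> i) \<le> ?S ?big \<pi>"
          using i by (intro member_le_sum) (auto simp: entries_def)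
        ultimately show False using nb by simp
      qed
      have xw: "\<bar>x i (\<pi> i)\<bar> = w j" by (rule entry_eq[OF j])
      have low0: "L * ?low i (\<pi> i) \<ge> 0" using L by (simp add: entries_def)
      show ?thesis
      proof (cases "j \<in> Mid")
        case True
        then have "i \<in> h" using i j by (auto simp: h_def)
        moreover have "w j powr q \<le> w k powr q"
          using w_mono[of k j] w0[OF j(2)] jk j k1 q by (intro powr_mono2) auto
        ultimately show ?thesis using low0 xw by simp
      next
        case False
        then have "j \<in> Low" using j jk by (auto simp: Low_def)
        then have "L * ?low i (\<pi> i) = \<bar>x i (\<pi> i)\<bar> powr q" using j L by (auto simp: entries_def)
        then show ?thesis by simp
      qed
    qed
    have "(\<Sum>i=1..n. \<bar>x i (\<pi> i)\<bar> powr q)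
        \<le> (\<Sum>i=1..n. (if i \<in> h then w k powr q else 0) + L * ?low i (\<pi> i))"
      by (rule sum_mono) (rule entry_le)
    also have "\<dots> = card h * w k powr q + L * ?S ?low \<pi>"
      using sum.inter_restrict[of "{1..n}" "\<lambda>_. w k powr q" h, symmetric] h
      by (simp add: sum.distrib sum_distrib_left)
    also have "\<dots> \<le> J * w k powr q + L * B"
      using ch nl B L by (intro add_mono mult_right_mono mult_left_mono) auto
    \<comment> \<open>Since \<open>J\<close>, \<open>B\<close> and \<open>q\<close> are at least 1,
      the factors \<open>J\<close> and \<open>B\<close> may be raised to the power
      \<open>q\<close>.\<close>
    also have "\<dots> \<le> (J * w k) powr q + (c * R * B) powr q"
    proof (rule add_mono)
      have "J * w k powr q \<le> J powr q * w k powr q"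
        using J1 q powr_mono[of 1 q J] by (intro mult_right_mono) auto
      then show "J * w k powr q \<le> (J * w k) powr q" using wk by (simp add: powr_mult)
      have "L * B \<le> L * B powr q"
        using L B q powr_mono[of 1 q B] by (intro mult_left_mono) auto
      then show "L * B \<le> (c * R * B) powr q" using cR B by (simp add: powr_mult L_def)
    qed
    also have "\<dots> \<le> (J * w k + c * R * B) powr q"
      using wk cR B q by (intro powr_add_powr_le) auto
    finally have "diag_norm \<pi> \<le> J * w k + c * R * B"
      using wk cR B by (intro diag_norm_le) auto
    also have "c * R * B = R / \<epsilon> * (c * c)" by (simp add: B_def)
    also have "c * c = t powr (- (2 * \<epsilon>))" by (simp add: c_def powr_add[symmetric])
    finally show ?thesis .
  qed

  let ?A1 = "{\<pi>. \<pi> permutes {1..n} \<and> 1 \<le> ?S ?big \<pi>}"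
    and ?A2 = "{\<pi>. \<pi> permutes {1..n} \<and> J * ln c \<le> ?S ?mid \<pi>}"
    and ?A3 = "{\<pi>. \<pi> permutes {1..n} \<and> - ln t \<le> ?S ?low \<pi>}"
  have "card {\<pi>. \<pi> permutes {1..n} \<and> J * w k + R / \<epsilon> * t powr (- (2 * \<epsilon>)) < diag_norm \<pi>}
      \<le> card (?A1 \<union> ?A2 \<union> ?A3)"
    by (rule card_mono) (use good in \<open>force simp: finite_permutations not_le\<close>)+
  also have "\<dots> \<le> card ?A1 + card ?A2 + card ?A3"
    by (meson add_mono card_Un_le order_refl order_trans)
  finally have "real (card {\<pi>. \<pi> permutes {1..n} \<and> J * w k + R / \<epsilon> * t powr (- (2 * \<epsilon>)) < diag_norm \<pi>})
      \<le> real (card ?A1) + real (card ?A2) + real (card ?A3)" by linarith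
  also have "\<dots> \<le> t * fact n + exp (exp 1) * t * fact n + exp (4 * exp 1) * t * fact n"
    by (intro add_mono big mid low)
  finally show ?thesis by (simp add: algebra_simps)
qed

end

section \<open>The two norm estimates\<close>

lemma (in ri_space) step_mem:
  fixes v :: "'k \<Rightarrow> real"
  assumes one: "(\<lambda>t. 1) \<in> E"
    and K: "finite K" and I: "\<And>k. k \<in> K \<Longrightarrow> I k \<in> sets borel"
  shows "(\<lambda>t. \<Sum>k\<in>K. v k * indicator (I k) t) \<in> E"
proof -
  have "(\<lambda>t. v k * indicator (I k) t) \<in> E" if k: "k \<in> K" for k
  proof -
    have meas: "(\<lambda>t. v k * indicator (I k) t) \<in> borel_measurable borel" using I[OF k] by simp
    have "distrib (\<lambda>t. v k * indicator (I k) t) s \<le> distrib (\<lambda>t. v k * 1) s" if "s \<ge> 0" for s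
      unfolding distrib_eq_lborel[OF meas] distrib_eq_lborel[OF borel_measurable_const]
      using that by (intro emeasure_mono) (auto simp: indicator_def)
    then show ?thesis by (rule mem_if_distrib_le(1)[OF scale_mem[OF one, of "v k"] meas])
  qed
  then show ?thesis using norm_sum_le[OF K, of "\<lambda>k t. v k * indicator (I k) t"] by simp
qed

lemma disjoint_unit_cells:
  fixes l :: "'k \<Rightarrow> nat"
  assumes "inj_on l K" "a > 0"
  shows "disjoint_family_on (\<lambda>k. {(real (l k) - 1) / a ..< real (l k) / a}) K"
    "disjoint_family_on (\<lambda>k. {(real (l k) - 1) / a <.. real (l k) / a}) K"
proof -
  have *: "l j = l k" if "real (l j) - 1 < real (l k)" "real (l k) - 1 < real (l j)" for j k
    using that by linarith
  have "j = k" if "j \<in> K" "k \<in> K" "u \<in> {(real (l j) - 1) / a ..< real (l j) / a}"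
    "u \<in> {(real (l k) - 1) / a ..< real (l k) / a}" for j k u
  proof -
    have "(real (l j) - 1) / a < real (l k) / a" "(real (l k) - 1) / a < real (l j) / a"
      using that by auto
    then have "l j = l k" using assms(2) by (intro *) (simp_all add: divide_less_cancel)
    then show ?thesis using that assms(1) by (auto dest: inj_onD)
  qed
  then show "disjoint_family_on (\<lambda>k. {(real (l k) - 1) / a ..< real (l k) / a}) K"
    unfolding disjoint_family_on_def by blast
  have "j = k" if "j \<in> K" "k \<in> K" "u \<in> {(real (l j) - 1) / a <.. real (l j) / a}"
    "u \<in> {(real (l k) - 1) / a <.. real (l k) / a}" for j k u
  proof -
    have "(real (l j) - 1) / a < real (l k) / a" "(real (l k) - 1) / a < real (l j) / a"
      using that by auto
    then have "l j = l k" using assms(2) by (intro *) (simp_all add: divide_less_cancel)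
    then show ?thesis using that assms(1) by (auto dest: inj_onD)
  qed
  then show "disjoint_family_on (\<lambda>k. {(real (l k) - 1) / a <.. real (l k) / a}) K"
    unfolding disjoint_family_on_def by blast
qed

lemma unit_cell_subset:
  fixes k :: nat
  assumes "1 \<le> k" "real k \<le> a"
  shows "{(real k - 1) / a .. real k / a} \<subseteq> {0..1}"
proof -
  have "0 \<le> (real k - 1) / a" "real k / a \<le> 1" using assms by (auto simp: zero_le_divide_iff)
  then show ?thesis unfolding atLeastatMost_subset_iff by blast
qed

locale ri_space_matrix = ri_space E N + enumerated_matrix n x pos w q
  for E :: "(real \<Rightarrow> real) set" and N :: "(real \<Rightarrow> real) \<Rightarrow> real"
    and n :: nat and x :: "nat \<Rightarrow> nat \<Rightarrow> real" and pos :: "nat \<Rightarrow> nat \<times> nat" and w :: "nat \<Rightarrow> real"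
    and q :: real +
  fixes l :: "(nat \<Rightarrow> nat) \<Rightarrow> nat"
  assumes one: "(\<lambda>t. 1) \<in> E" "N (\<lambda>t. 1) = 1"
    and w_eq: "w = matrix_rearr n x"
    and l: "bij_betw l {\<pi>. \<pi> permutes {1..n}} {1..fact n}"
begin

text \<open>\<open>U_op\<close> vanishes at the grid points; this variant is decreasing on \<open>(0,1]\<close>.\<close>

definition u :: "real \<Rightarrow> real" where
  "u t = (\<Sum>k=1..n. w k * indicator {(real k - 1) / n <.. real k / n} t)"

lemma T_op_eq:
  "T_op q n l x = (\<lambda>t. \<Sum>\<pi> | \<pi> permutes {1..n}. diag_norm \<pi> *
     indicator {(real (l \<pi>) - 1) / fact n ..< real (l \<pi>) / fact n} t)"
  by (simp add: T_op_def diag_norm_def fun_eq_iff)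

lemma T_op_borel: "T_op q n l x \<in> borel_measurable borel"
  unfolding T_op_eq
  by (intro borel_measurable_sum borel_measurable_times borel_measurable_indicator) auto

lemma u_borel: "u \<in> borel_measurable borel"
  unfolding u_def[abs_def]
  by (intro borel_measurable_sum borel_measurable_times borel_measurable_indicator) auto

lemma U_op_borel: "U_op n x \<in> borel_measurable borel"
  unfolding U_op_def[abs_def]
  by (intro borel_measurable_sum borel_measurable_times borel_measurable_indicator) auto

lemma u_mem: "u \<in> E"
  unfolding u_def[abs_def] by (rule step_mem[OF one(1)]) auto

lemma U_op_mem: "U_op n x \<in> E"
  unfolding U_op_def[abs_def] by (rule step_mem[OF one(1)]) auto

lemma T_op_mem: "T_op q n l x \<in> E"
  unfolding T_op_eq by (rule step_mem[OF one(1)]) (auto simp: finite_permutations)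

lemma diag_norm_nonneg: "diag_norm \<pi> \<ge> 0"
  by (simp add: diag_norm_def)

text \<open>The value does not involve \<open>l\<close>; from here on the distribution of T is a
  matter of counting permutations.\<close>

lemma distrib_T_op:
  assumes "s \<ge> 0"
  shows "distrib (T_op q n l x) s
    = ennreal (card {\<pi>. \<pi> permutes {1..n} \<and> s < diag_norm \<pi>} / fact n)"
proof -
  have l_in: "1 \<le> l \<pi>" "real (l \<pi>) \<le> fact n" if "\<pi> permutes {1..n}" for \<pi>
  proof -
    have "l \<pi> \<in> {1..fact n}" using l that by (auto simp: bij_betw_def)
    then have "1 \<le> l \<pi>" "l \<pi> \<le> fact n" by auto
    then show "1 \<le> l \<pi>" "real (l \<pi>) \<le> fact n" by (metis of_nat_fact of_nat_le_iff)+
  qed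
  have "distrib (T_op q n l x) s
    = ennreal (card {\<pi> \<in> {\<pi>. \<pi> permutes {1..n}}. s < \<bar>diag_norm \<pi>\<bar>} / fact n)"
    unfolding T_op_eq
  proof (rule distrib_step)
    fix \<pi> assume "\<pi> \<in> {\<pi>. \<pi> permutes {1..n}}"
    then show "{(real (l \<pi>) - 1) / fact n ..< real (l \<pi>) / fact n} \<subseteq> {0..1}"
      using l_in by (intro subset_trans[OF _ unit_cell_subset[of "l \<pi>" "fact n"]]) auto
    show "emeasure lborel {(real (l \<pi>) - 1) / fact n ..< real (l \<pi>) / fact n} = ennreal (1 / fact n)"
      by (simp add: divide_right_mono diff_divide_distrib)
  next
    show "disjoint_family_on (\<lambda>\<pi>. {(real (l \<pi>) - 1) / fact n ..< real (l \<pi>) / fact n})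
       {\<pi>. \<pi> permutes {1..n}}"
      using l by (intro disjoint_unit_cells) (auto simp: bij_betw_def)
  qed (use assms in \<open>auto simp: finite_permutations\<close>)
  then show ?thesis using diag_norm_nonneg by simp
qed

lemma u_cells:
  "k \<in> {1..n} \<Longrightarrow> {(real k - 1) / n <.. real k / n} \<subseteq> {0..1}"
  "k \<in> {1..n} \<Longrightarrow> emeasure lborel {(real k - 1) / n <.. real k / n} = ennreal (1 / n)"
  "disjoint_family_on (\<lambda>k. {(real k - 1) / n <.. real k / n}) {1..n}"
proof -
  show "{(real k - 1) / n <.. real k / n} \<subseteq> {0..1}" if "k \<in> {1..n}"
    using that by (intro subset_trans[OF _ unit_cell_subset[of k "real n"]]) auto
  show "emeasure lborel {(real k - 1) / n <.. real k / n} = ennreal (1 / n)"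
    by (simp add: divide_right_mono diff_divide_distrib)
  show "disjoint_family_on (\<lambda>k. {(real k - 1) / n <.. real k / n}) {1..n}"
    using disjoint_unit_cells(2)[of "\<lambda>k. k" "{1..n}" "real n"] n by simp
qed

lemma w_abs: "k \<in> {1..n} \<Longrightarrow> \<bar>w k\<bar> = w k"
  using w_nonneg n_le_square by simp

lemma distrib_u:
  assumes "s \<ge> 0"
  shows "distrib u s = ennreal (card {k \<in> {1..n}. s < w k} / n)"
proof -
  have "distrib u s = ennreal (card {k \<in> {1..n}. s < \<bar>w k\<bar>} / n)"
    unfolding u_def[abs_def] by (rule distrib_step) (use assms n u_cells in auto)
  then show ?thesis using w_abs by (simp cong: conj_cong)
qed

lemma distrib_U_op:
  assumes "s \<ge> 0"
  shows "distrib (U_op n x) s = ennreal (card {k \<in> {1..n}. s < w k} / n)"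
proof -
  have sub: "{(real k - 1) / n <..< real k / n} \<subseteq> {(real k - 1) / n <.. real k / n}" for k by auto
  have "distrib (U_op n x) s = ennreal (card {k \<in> {1..n}. s < \<bar>w k\<bar>} / n)"
    unfolding U_op_def[abs_def] w_eq[symmetric]
  proof (rule distrib_step)
    show "disjoint_family_on (\<lambda>k. {(real k - 1) / n <..< real k / n}) {1..n}"
      using u_cells(3) sub unfolding disjoint_family_on_def by blast
    fix k assume k: "k \<in> {1..n}"
    then show "{(real k - 1) / n <..< real k / n} \<subseteq> {0..1}" using u_cells(1) sub by blast
    show "emeasure lborel {(real k - 1) / n <..< real k / n} = ennreal (1 / n)"
      by (simp add: divide_right_mono diff_divide_distrib)
  qed (use assms n in auto)
  then show ?thesis using w_abs by (simp cong: conj_cong)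
qed

lemma N_u: "N u = N (U_op n x)"
  using mem_if_distrib_le(2)[OF u_mem U_op_borel] mem_if_distrib_le(2)[OF U_op_mem u_borel]
  by (simp add: distrib_u distrib_U_op antisym)

lemma mean_le: "(\<Sum>k=1..n. w k) / n \<le> N (U_op n x)"
  unfolding N_u[symmetric] u_def[abs_def]
  using u_mem n u_cells w_nonneg n_le_square
  by (intro mean_le_norm_step one) (auto simp: u_def[abs_def])

text \<open>The right-closed cells of \<open>u\<close> fit the ceiling: a grid point k/n belongs to
  cell \<open>k\<close>.\<close>

lemma u_eq:
  fixes t :: real
  assumes "t \<in> {0<..<1}"
  shows "u t = w (nat \<lceil>n * t\<rceil>)"
proof -
  let ?k = "nat \<lceil>n * t\<rceil>"
  have nt: "0 < n * t" "n * t < n" using n assms by auto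
  then have "1 \<le> ?k" "?k \<le> n" by linarith+
  then have k: "?k \<in> {1..n}" by (simp only: atLeastAtMost_iff)
  have "t \<in> {(real k - 1) / n <.. real k / n} \<longleftrightarrow> k = ?k" for k
  proof -
    have "t \<in> {(real k - 1) / n <.. real k / n} \<longleftrightarrow> real k - 1 < n * t \<and> n * t \<le> k"
      using n by (auto simp: field_simps)
    also have "\<dots> \<longleftrightarrow> k = ?k" using nt by linarith
    finally show ?thesis .
  qed
  then have "u t = (\<Sum>k=1..n. if k = ?k then w k else 0)"
    unfolding u_def by (intro sum.cong) (auto simp: indicator_def)
  then show ?thesis using k by simp
qed

lemma u_decreasing:
  fixes t t' :: real
  assumes "0 < t" "t \<le> t'" "t' < 1"
  shows "0 \<le> u t'" "u t' \<le> u t"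
proof -
  have nt: "0 < n * t" "n * t' < n" "n * t \<le> n * t'" using n assms by (auto intro: mult_left_mono)
  then have k: "1 \<le> nat \<lceil>n * t\<rceil>" "1 \<le> nat \<lceil>n * t'\<rceil>" "nat \<lceil>n * t\<rceil> \<le> nat \<lceil>n * t'\<rceil>" "nat \<lceil>n * t'\<rceil> \<le> n"
    by linarith+
  have eq: "u t = w (nat \<lceil>n * t\<rceil>)" "u t' = w (nat \<lceil>n * t'\<rceil>)"
    using u_eq[of t] u_eq[of t'] assms by auto
  have k2: "nat \<lceil>n * t'\<rceil> \<le> n\<^sup>2" using k(4) n_le_square by (rule order_trans)
  show "u t' \<le> u t" unfolding eq by (rule w_mono[OF k(1,3) k2])
  show "0 \<le> u t'" unfolding eq by (rule w_nonneg) (use k k2 in \<open>simp only: atLeastAtMost_iff\<close>)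
qed

section \<open>The lower norm estimate\<close>

lemma U_op_le_T_op: "N (U_op n x) \<le> 12 * N (T_op q n l x)"
proof -
  have "distrib (U_op n x) s \<le> of_nat 12 * distrib (T_op q n l x) s" if s: "s \<ge> 0" for s
  proof -
    have "real (card {k \<in> {1..n}. s < w k}) / n
        \<le> 12 * (real (card {\<pi>. \<pi> permutes {1..n} \<and> s < diag_norm \<pi>}) / fact n)"
      using card_diag_norm_gt_lower[OF s] by (simp add: field_simps)
    then have "ennreal (real (card {k \<in> {1..n}. s < w k}) / n)
        \<le> ennreal (12 * (real (card {\<pi>. \<pi> permutes {1..n} \<and> s < diag_norm \<pi>}) / fact n))"
      by (rule ennreal_leI)
    also have "\<dots> = of_nat 12 * distrib (T_op q n l x) s"
      unfolding distrib_T_op[OF s] by (subst ennreal_mult) auto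
    finally show ?thesis unfolding distrib_U_op[OF s] .
  qed
  then show ?thesis using norm_le_dilation(2)[OF T_op_mem U_op_borel, of 12] by simp
qed

text \<open>If the tail mean is at most \<open>w n powr q\<close>, its root is below
  \<open>w n\<close>, hence below the mean of the first \<open>n\<close> values and the norm of U.
  Otherwise T reaches (m/2)^(1/q) with probability at least 1/12, and 24 is 12 times the bound 2 for
  2^(1/q).\<close>

lemma tail_le_T_op:
  assumes m: "m = (\<Sum>k=n+1..n\<^sup>2. w k powr q) / n"
  shows "m powr (1 / q) \<le> 24 * N (T_op q n l x)"
proof (cases "w n powr q < m")
  case False
  have "m \<ge> 0" unfolding m by (simp add: sum_nonneg)
  then have "m powr (1 / q) \<le> (w n powr q) powr (1 / q)"
    using False q by (intro powr_mono2) auto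
  also have "\<dots> = w n" using w_nonneg[of n] n n_le_square q by (simp add: powr_powr)
  also have "\<dots> \<le> (\<Sum>k=1..n. w k) / n"
    using sum_mono[of "{1..n}" "\<lambda>_. w n" w] w_mono n_le_square n by (simp add: field_simps)
  also have "\<dots> \<le> 12 * N (T_op q n l x)" using mean_le U_op_le_T_op by linarith
  finally show ?thesis using norm_nonneg[OF T_op_mem] by simp
next
  case True
  let ?y = "(m / 2) powr (1 / q)"
  have m0: "m \<ge> 0" unfolding m by (simp add: sum_nonneg)
  have "distrib (\<lambda>t. ?y * 1) s \<le> of_nat 12 * distrib (T_op q n l x) s" if s: "s \<ge> 0" for s
  proof (cases "s < ?y")
    case False
    then have "distrib (\<lambda>t. ?y * 1) s = 0" by (simp add: distrib_def)
    then show ?thesis by simp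
  next
    case less: True
    have "fact n \<le> 12 * real (card {\<pi>. \<pi> permutes {1..n} \<and> ?y \<le> diag_norm \<pi>})"
      by (rule card_diag_norm_ge_tail[OF m True])
    also have "\<dots> \<le> 12 * real (card {\<pi>. \<pi> permutes {1..n} \<and> s < diag_norm \<pi>})"
      using less by (intro mult_left_mono of_nat_mono card_mono) (auto simp: finite_permutations)
    finally have "1 \<le> 12 * (real (card {\<pi>. \<pi> permutes {1..n} \<and> s < diag_norm \<pi>}) / fact n)"
      by (simp add: field_simps)
    then have "ennreal 1 \<le> ennreal (12 * (real (card {\<pi>. \<pi> permutes {1..n} \<and> s < diag_norm \<pi>}) / fact n))"
      by (rule ennreal_leI)
    also have "\<dots> = of_nat 12 * distrib (T_op q n l x) s"
      unfolding distrib_T_op[OF s] by (subst ennreal_mult) auto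
    finally show ?thesis using distrib_le_1[of "\<lambda>t. ?y * 1" s] by simp
  qed
  then have "N (\<lambda>t. ?y * 1) \<le> 12 * N (T_op q n l x)"
    using norm_le_dilation(2)[OF T_op_mem, of "\<lambda>t. ?y * 1" 12] by simp
  then have y: "?y \<le> 12 * N (T_op q n l x)"
    using norm_scale[OF one(1), of ?y] one(2) by simp
  have "m powr (1 / q) = 2 powr (1 / q) * ?y"
    using m0 by (simp add: powr_divide)
  also have "\<dots> \<le> 2 * ?y"
    using q powr_mono[of "1 / q" 1 2] by (intro mult_right_mono) auto
  finally show ?thesis using y by linarith
qed

section \<open>The upper norm estimate\<close>

text \<open>The function \<open>h\<close> in the proof is decreasing, and T exceeds h(t) with
  probability at most \<open>D * t\<close>; hence T is dominated by \<open>h\<close> up to a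
  \<open>D\<close>-fold dilation. Positivity of \<open>R\<close> is what the normalisation by
  \<open>c * R\<close> requires.\<close>

lemma T_op_le_pos:
  fixes D J :: nat and \<epsilon> :: real
  assumes \<epsilon>: "0 < \<epsilon>" "\<epsilon> \<le> 1" and J: "1 \<le> \<epsilon> * J" and D: "1 + exp (exp 1) + exp (4 * exp 1) \<le> real D"
    and g: "(\<lambda>t. t powr (- (2 * \<epsilon>))) \<in> E" and R0: "R > 0"
    and R: "N (U_op n x) + ((\<Sum>k=n+1..n\<^sup>2. w k powr q) / n) powr (1 / q) \<le> R"
  shows "N (T_op q n l x) \<le> D * (J + N (\<lambda>t. t powr (- (2 * \<epsilon>))) / \<epsilon>) * R"
proof -
  let ?m = "(\<Sum>k=n+1..n\<^sup>2. w k powr q) / n" and ?g = "\<lambda>t. t powr (- (2 * \<epsilon>)) :: real"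
  define h where "h t = J * u t + R / \<epsilon> * t powr (- (2 * \<epsilon>))" for t
  have U0: "N (U_op n x) \<ge> 0" by (rule norm_nonneg[OF U_op_mem])
  have tail0: "?m powr (1 / q) \<ge> 0" by simp
  have m0: "?m \<ge> 0" by (simp add: sum_nonneg)
  have head: "(\<Sum>k=1..n. w k) / n \<le> R" using mean_le tail0 R by linarith
  have "y = (y powr (1 / q)) powr q" if "y \<ge> 0" for y :: real using that q by (simp add: powr_powr)
  from this[OF m0] have "?m = (?m powr (1 / q)) powr q" .
  also have "\<dots> \<le> R powr q" using U0 q R by (intro powr_mono2) auto
  finally have tail: "?m \<le> R powr q" .
  have h_borel: "h \<in> borel_measurable borel" unfolding h_def[abs_def] using u_borel by measurable
  have hE: "h \<in> E" "N h \<le> J * N (U_op n x) + R / \<epsilon> * N ?g"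
  proof -
    have "h \<in> E \<and> N h \<le> N (\<lambda>t. J * u t) + N (\<lambda>t. R / \<epsilon> * ?g t)"
      unfolding h_def[abs_def]
      by (intro conjI add_mem norm_triangle scale_mem u_mem g)
    then show "h \<in> E" "N h \<le> J * N (U_op n x) + R / \<epsilon> * N ?g"
      using norm_scale[OF u_mem, of J] norm_scale[OF g, of "R / \<epsilon>"] R0 \<epsilon> N_u
      by (simp_all del: times_divide_eq_left)
  qed
  have "distrib (T_op q n l x) s \<le> ennreal (real D) * distrib h s" for s
  proof (rule distrib_le_decreasing[OF T_op_borel h_borel])
    fix t :: real assume t: "t \<in> {0<..<1}"
    show h0: "h t \<ge> 0" unfolding h_def using u_decreasing(1)[of t t] t R0 \<epsilon> by simp
    have "real (card {\<pi>. \<pi> permutes {1..n} \<and> h t < diag_norm \<pi>})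
        \<le> (1 + exp (exp 1) + exp (4 * exp 1)) * t * fact n"
      using card_diag_norm_gt_upper[OF _ _ \<epsilon> J R0 head tail refl, of t] t
      by (simp add: h_def u_eq)
    also have "\<dots> \<le> D * t * fact n" using D t by (intro mult_right_mono) auto
    finally show "distrib (T_op q n l x) (h t) \<le> ennreal (D * t)"
      unfolding distrib_T_op[OF h0] by (intro ennreal_leI) (simp add: field_simps)
  next
    fix t t' :: real assume t: "0 < t" "t \<le> t'" "t' < 1"
    show "h t' \<le> h t" unfolding h_def
      using u_decreasing(2)[OF t] t R0 \<epsilon>
      by (intro add_mono mult_left_mono powr_mono2') auto
  next
    show "real D \<ge> 1" using D exp_gt_zero[of "exp 1 :: real"] exp_gt_zero[of "4 * exp 1 :: real"] by linarith
  qed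
  moreover have "D > 0"
    using D exp_gt_zero[of "exp 1 :: real"] exp_gt_zero[of "4 * exp 1 :: real"] by (cases D) auto
  ultimately have "N (T_op q n l x) \<le> D * N h"
    by (intro norm_le_dilation[OF hE(1) T_op_borel]) (simp_all add: ennreal_of_nat_eq_real_of_nat)
  also have "\<dots> \<le> D * (J * R + R / \<epsilon> * N ?g)"
  proof (rule mult_left_mono)
    have "N (U_op n x) \<le> R" using tail0 R by linarith
    then have "J * N (U_op n x) \<le> J * R" by (rule mult_left_mono) simp
    then show "N h \<le> J * R + R / \<epsilon> * N ?g" using hE(2) by linarith
  qed simp
  also have "\<dots> = D * (J + N ?g / \<epsilon>) * R" by (simp add: algebra_simps)
  finally show ?thesis .
qed

text \<open>Passing to the limit covers the case where the bracket vanishes.\<close>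

lemma T_op_le:
  fixes D J :: nat and \<epsilon> :: real
  assumes \<epsilon>: "0 < \<epsilon>" "\<epsilon> \<le> 1" and J: "1 \<le> \<epsilon> * J" and D: "1 + exp (exp 1) + exp (4 * exp 1) \<le> real D"
    and g: "(\<lambda>t. t powr (- (2 * \<epsilon>))) \<in> E"
  shows "N (T_op q n l x) \<le> D * (J + N (\<lambda>t. t powr (- (2 * \<epsilon>))) / \<epsilon>) *
    (N (U_op n x) + ((\<Sum>k=n+1..n\<^sup>2. w k powr q) / n) powr (1 / q))" (is "_ \<le> ?K * ?R")
proof (rule field_le_epsilon)
  fix e :: real assume e: "e > 0"
  have K: "?K \<ge> 0" using norm_nonneg[OF g] \<epsilon> by simp
  have R: "?R \<ge> 0" using norm_nonneg[OF U_op_mem] by simp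
  have "N (T_op q n l x) \<le> ?K * (?R + e / (?K + 1))"
    using K R e by (intro T_op_le_pos \<epsilon> J D g) (auto intro: add_nonneg_pos)
  also have "\<dots> \<le> ?K * ?R + e"
  proof -
    have "a * (b + e / (a + 1)) \<le> a * b + e" if "a \<ge> 0" for a b :: real
      using that e by (simp add: field_simps)
    from this[OF K] show ?thesis .
  qed
  finally show "N (T_op q n l x) \<le> ?K * ?R + e" .
qed

end

section \<open>Choice of the constants and conclusion\<close>

theorem theorem13:
  fixes E :: "(real \<Rightarrow> real) set" and N :: "(real \<Rightarrow> real) \<Rightarrow> real" and q :: real
  assumes "ri_space E N"
    and "(\<lambda>t. 1) \<in> E" and "N (\<lambda>t. 1) = 1"
    and "maximal_space E N \<or> minimal_space E N"
    and "\<exists>p\<ge>1. Lp_set p \<subseteq> E"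
    and "1 \<le> q"
  shows "\<exists>c>0. \<exists>C>0. \<forall>(n::nat)\<ge>1. \<forall>(x :: nat \<Rightarrow> nat \<Rightarrow> real) l.
      bij_betw l {\<pi>. \<pi> permutes {1..n}} {1..fact n} \<longrightarrow>
      (let R = N (U_op n x) +
               (1 / real n * (\<Sum>k=n+1..n\<^sup>2. matrix_rearr n x k powr q)) powr (1/q)
       in c * R \<le> N (T_op q n l x) \<and> N (T_op q n l x) \<le> C * R)"
proof -
  interpret ri_space E N by fact
  obtain p where p: "p \<ge> 1" "Lp_set p \<subseteq> E" using assms(5) by blast
  \<comment> \<open>This choice turns t^(-2\<open>\<epsilon>\<close>) into t^(-1/(2p)), a member of
    \<open>Lp_set p\<close>. The constant \<open>C\<close> below depends only on \<open>p\<close>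
    and \<open>N g\<close>.\<close>
  define \<epsilon> where "\<epsilon> = 1 / (4 * p)"
  define g where "g = (\<lambda>t::real. t powr (- (2 * \<epsilon>)))"
  define J where "J = nat \<lceil>4 * p\<rceil>"
  define D where "D = nat \<lceil>1 + exp (exp 1) + exp (4 * exp 1) :: real\<rceil>"
  define C where "C = D * (J + N g / \<epsilon>)"
  have \<epsilon>: "0 < \<epsilon>" "\<epsilon> \<le> 1" using p by (auto simp: \<epsilon>_def)
  have "2 * \<epsilon> = 1 / (2 * p)" by (simp add: \<epsilon>_def)
  then have g: "g \<in> E" using powr_mem_Lp_set[OF p(1)] p(2) unfolding g_def by auto
  have J: "1 \<le> \<epsilon> * J"
  proof -
    have "4 * p \<le> J" unfolding J_def by linarith
    then show ?thesis using p by (simp add: \<epsilon>_def field_simps)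
  qed
  have D: "1 + exp (exp 1) + exp (4 * exp 1) \<le> real D" unfolding D_def by linarith
  have "D > 0" using D exp_gt_zero[of "exp 1 :: real"] exp_gt_zero[of "4 * exp 1 :: real"]
    by (cases D) auto
  moreover have "J > 0" using J \<epsilon> by (cases J) auto
  ultimately have "C > 0"
    unfolding C_def using norm_nonneg[OF g] \<epsilon> by (intro mult_pos_pos add_pos_nonneg) auto
  have bounds: "1 / 36 * R \<le> N (T_op q n l x) \<and> N (T_op q n l x) \<le> C * R"
    if n: "n \<ge> 1" and l: "bij_betw l {\<pi>. \<pi> permutes {1..n}} {1..fact n}"
      and R: "R = N (U_op n x) + (1 / real n * (\<Sum>k=n+1..n\<^sup>2. matrix_rearr n x k powr q)) powr (1/q)"
    for n x l R
  proof -
    obtain pos where pos: "bij_betw pos {1..n\<^sup>2} ({1..n} \<times> {1..n})"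
      "\<And>k. k \<in> {1..n\<^sup>2} \<Longrightarrow> matrix_rearr n x k = \<bar>x (fst (pos k)) (snd (pos k))\<bar>"
      "\<And>j k. 1 \<le> j \<Longrightarrow> j \<le> k \<Longrightarrow> k \<le> n\<^sup>2 \<Longrightarrow> matrix_rearr n x k \<le> matrix_rearr n x j"
      using matrix_rearr_enumeration by metis
    interpret ri_space_matrix E N n x pos "matrix_rearr n x" q l
      by unfold_locales (use n l pos assms in auto)
    have R': "R = N (U_op n x) + ((\<Sum>k=n+1..n\<^sup>2. matrix_rearr n x k powr q) / n) powr (1 / q)"
      unfolding R by simp
    \<comment> \<open>Here 36 = 12 + 24, from the two terms of \<open>R\<close>.\<close>
    have "R \<le> 36 * N (T_op q n l x)"
      using U_op_le_T_op tail_le_T_op[OF refl] unfolding R' by linarith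
    moreover have "N (T_op q n l x) \<le> C * R"
      using T_op_le[OF \<epsilon> J D g[unfolded g_def]] unfolding C_def g_def R' .
    ultimately show ?thesis by simp
  qed
  show ?thesis
    by (rule exI[of _ "1 / 36"], rule conjI, simp, rule exI[of _ C], rule conjI, fact)
      (use bounds in \<open>unfold Let_def, blast\<close>)
qed

end
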